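(* Let $\Omega\subset\mathbb{R}^d$, $N\in\mathbb{N}$, and let $\mathcal{G}_{\boldsymbol{\zeta}^N}$, $\mathcal{G}_{\boldsymbol{\vartheta}^N}$ be the Fourier features spaces defined in the context. Under the structural Assumption 1 on $\mathcal{P}$ and $\mathcal{B}$ (see context), the minimization problem $$\min_{u_{\boldsymbol{\alpha}}\in\mathcal{G}_{\boldsymbol{\zeta}^N},\ m_{\boldsymbol{\beta}}\in\mathcal{G}_{\boldsymbol{\vartheta}^N},\ \overline{H}\in\mathbb{R}}\ \|u_{\boldsymbol{\alpha}}\|_{L^2(\Omega)}^2+\|m_{\boldsymbol{\beta}}\|_{L^2(\Omega)}^2+|\overline{H}|^2+\gamma\|\mathcal{P}(u_{\boldsymbol{\alpha}},m_{\boldsymbol{\beta}},\overline{H})\|_{L^2(\Omega)}^2+\gamma\|\mathcal{B}(u_{\boldsymbol{\alpha}},m_{\boldsymbol{\beta}})\|_{L^2(\partial\Omega)}^2+\gamma\Big|\int_\Omega m_{\boldsymbol{\beta}}\,dx-1\Big|^2+\gamma\Big|\int_\Omega u_{\boldsymbol{\alpha}}\,dx\Big|^2$$ admits a minimizer for any given $\gamma\ge0$.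
   Context: Let $\mathcal{O}=\{\zeta(\cdot,\omega)\mid\omega\in\mathcal{W}\}$ be a family of base functions on $\Omega$ parametrized by a set $\mathcal{W}$, with $\sup_{x\in\Omega}|\zeta(x,\omega)|\le1$ for all $\omega\in\mathcal{W}$ and $\int_\Omega\zeta^2(x,\omega)\,dx<\infty$. Given samples $\{\omega_i\}_{i=1}^N,\{\tau_i\}_{i=1}^N\subset\mathcal{W}$, put $\boldsymbol{\zeta}^N=[\zeta(\cdot,\omega_1),\dots,\zeta(\cdot,\omega_N)]^T$, $\boldsymbol{\vartheta}^N=[\zeta(\cdot,\tau_1),\dots,\zeta(\cdot,\tau_N)]^T$, and $\mathcal{G}_{\boldsymbol{\zeta}^N}=\{\boldsymbol{\alpha}^T\boldsymbol{\zeta}^N\mid\boldsymbol{\alpha}\in\mathbb{R}^N\}$, $\mathcal{G}_{\boldsymbol{\vartheta}^N}=\{\boldsymbol{\beta}^T\boldsymbol{\vartheta}^N\mid\boldsymbol{\beta}\in\mathbb{R}^N\}$; elements are denoted $u_{\boldsymbol{\alpha}}=\boldsymbol{\alpha}^T\boldsymbol{\zeta}^N$, $m_{\boldsymbol{\beta}}=\boldsymbol{\beta}^T\boldsymbol{\vartheta}^N$. It is implicit that these functions lie in the spaces $\mathcal{U}$, $\mathcal{V}$ below on which the operators act and that the integrals in the objective are meaningful. $\mathcal{P}$ is a nonlinear (possibly vector-valued) differential operator and $\mathcal{B}$ a boundary operator, on Banach spaces $\mathcal{U}$ (for $u$) and $\mathcal{V}$ (for $m$). Assumption 1: for $1\le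 Q_b\le Q$, $1\le D_b\le D$ there exist bounded linear operators $L_1,\dots,L_{Q_b}\in\mathcal{L}(\mathcal{U};C(\partial\Omega))$, $L_{Q_b+1},\dots,L_Q\in\mathcal{L}(\mathcal{U};C(\operatorname{int}\Omega))$, $J_1,\dots,J_{D_b}\in\mathcal{L}(\mathcal{V};C(\partial\Omega))$, $J_{D_b+1},\dots,J_D\in\mathcal{L}(\mathcal{V};C(\operatorname{int}\Omega))$, and continuous nonlinear maps $P$, $B$ such that $\mathcal{P}(u,m,\overline{H})(x)=P(L_{Q_b+1}(u)(x),\dots,L_Q(u)(x),J_{D_b+1}(m)(x),\dots,J_D(m)(x),\overline{H})$ for $x\in\operatorname{int}\Omega$, and $\mathcal{B}(u,m)(x)=B(L_1(u)(x),\dots,L_{Q_b}(u)(x),J_1(m)(x),\dots,J_{D_b}(m)(x))$ for $x\in\partial\Omega$.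
   Formalization: Elements of U and V equal a.e. on Ω are identified (the claim fails without this, e.g. Ω={0}, B(u)=exp(-u), γ>0), and the L²(Ω) norm of P(u,m,H) is taken over int Ω, the only place where Assumption 1 prescribes it. *)

theory Defs
  imports "HOL-Analysis.Analysis"
begin

section \<open>Hausdorff measure\<close>

text \<open>The boundary norm uses the surface measure on \<open>\<partial>\<Omega>\<close>, that is, the
  \<open>(d - 1)\<close>-dimensional Hausdorff measure. The normalisation makes the \<open>d\<close>-dimensional
  one agree with Lebesgue measure, and the \<open>0\<close>-dimensional one the counting measure.\<close>

definition hausdorff_weight :: "nat \<Rightarrow> real \<Rightarrow> 'a::metric_space set \<Rightarrow> ennreal" where
  "hausdorff_weight s \<delta> C =
     (if C = {} then 0
      else if bounded C \<and> diameter C \<le> \<delta>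
           then ennreal (unit_ball_vol (real s) * (diameter C / 2) ^ s)
      else top)"

text \<open>The library's \<^const>\<open>outer_measure\<close> takes the infimum over countable disjoint covers;
  disjointness is no restriction here, since the weight is monotone. Covers that use a set of
  diameter greater than \<open>\<delta>\<close> have weight \<open>\<infinity>\<close>.\<close>

definition hausdorff_outer :: "nat \<Rightarrow> 'a::metric_space set \<Rightarrow> ennreal" where
  "hausdorff_outer s A = (SUP \<delta>\<in>{0<..}. outer_measure UNIV (hausdorff_weight s \<delta>) A)"

definition hausdorff_measure :: "nat \<Rightarrow> 'a::metric_space measure" where
  "hausdorff_measure s = measure_of UNIV (sets borel) (hausdorff_outer s)"

text \<open>The lemmas up to \<open>emeasure_hausdorff_measure\<close> verify that the outer measure is countably
  additive on the Borel sets (Caratheodory's criterion), so that \<^const>\<open>measure_of\<close> does not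
  fall back to the zero measure.\<close>

lemma hausdorff_weight_mono:
  assumes "A \<subseteq> B" shows "hausdorff_weight s \<delta> A \<le> hausdorff_weight s \<delta> B"
proof (cases "A \<noteq> {} \<and> bounded B \<and> diameter B \<le> \<delta>")
  case True
  then have "bounded A" "diameter A \<le> diameter B" "B \<noteq> {}" "0 \<le> diameter A"
    using assms by (auto intro: bounded_subset diameter_subset diameter_ge_0)
  then show ?thesis
    using True by (auto simp: hausdorff_weight_def intro!: ennreal_leI mult_left_mono power_mono)
next
  case False
  then show ?thesis using assms by (auto simp: hausdorff_weight_def)
qed

lemma hausdorff_weight_antimono:
  assumes "\<delta> \<le> \<epsilon>" shows "hausdorff_weight s \<epsilon> A \<le> hausdorff_weight s \<delta> A"
  using assms by (auto simp: hausdorff_weight_def)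

lemma outer_measure_space_hausdorff_weight:
  "outer_measure_space UNIV (outer_measure UNIV (hausdorff_weight s \<delta>))"
proof -
  have "outer_measure_space (Pow UNIV) (outer_measure UNIV (hausdorff_weight s \<delta> :: 'a set \<Rightarrow> ennreal))"
  proof (rule ring_of_sets.outer_measure_space_outer_measure)
    show "ring_of_sets UNIV (UNIV :: 'a set set)"
      using ring_of_sets_Pow[of "UNIV :: 'a set"] by simp
    show "positive UNIV (hausdorff_weight s \<delta>)"
      by (simp add: positive_def hausdorff_weight_def)
    show "increasing UNIV (hausdorff_weight s \<delta>)"
      by (simp add: increasing_def hausdorff_weight_mono)
  qed
  then show ?thesis by simp
qed

lemma outer_measure_space_hausdorff: "outer_measure_space UNIV (hausdorff_outer s)"
proof -
  let ?O = "\<lambda>\<delta>. outer_measure UNIV (hausdorff_weight s \<delta> :: 'a set \<Rightarrow> ennreal)"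
  have 1: "?O \<delta> {} = 0" for \<delta>
    using outer_measure_space_hausdorff_weight[of s \<delta>, where 'a='a] by (simp add: outer_measure_space_def positive_def)
  have 2: "?O \<delta> A \<le> ?O \<delta> B" if "A \<subseteq> B" for \<delta> A B
    using outer_measure_space_hausdorff_weight[of s \<delta>, where 'a='a] that by (auto simp: outer_measure_space_def increasing_def)
  have 3: "?O \<delta> (\<Union>i. A i) \<le> (\<Sum>i. ?O \<delta> (A i))" if "disjoint_family A" for \<delta> and A :: "nat \<Rightarrow> 'a set"
    using outer_measure_space_hausdorff_weight[of s \<delta>, where 'a='a] that
    by (simp add: outer_measure_space_def countably_subadditive_def)
  have 4: "hausdorff_outer s (\<Union>i. A i) \<le> (\<Sum>i. hausdorff_outer s (A i))" if "disjoint_family A" for A :: "nat \<Rightarrow> 'a set"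
    unfolding hausdorff_outer_def
  proof (rule SUP_least)
    fix \<delta> :: real assume d: "\<delta> \<in> {0<..}"
    have "?O \<delta> (\<Union>i. A i) \<le> (\<Sum>i. ?O \<delta> (A i))" using that by (rule 3)
    also have "\<dots> \<le> (\<Sum>i. SUP \<delta>\<in>{0<..}. ?O \<delta> (A i))"
      using d by (intro suminf_le SUP_upper) auto
    finally show "?O \<delta> (\<Union>i. A i) \<le> (\<Sum>i. SUP \<delta>\<in>{0<..}. ?O \<delta> (A i))" .
  qed
  show ?thesis
    unfolding outer_measure_space_def positive_def increasing_def countably_subadditive_def
  proof (intro conjI ballI allI impI)
    show "hausdorff_outer s ({} :: 'a set) = 0" by (simp add: hausdorff_outer_def 1)
  next
    fix x y :: "'a set" assume "x \<subseteq> y"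
    then show "hausdorff_outer s x \<le> hausdorff_outer s y"
      unfolding hausdorff_outer_def by (intro SUP_mono) (auto intro: 2)
  next
    fix A :: "nat \<Rightarrow> 'a set" assume "disjoint_family A"
    then show "hausdorff_outer s (\<Union>i. A i) \<le> (\<Sum>i. hausdorff_outer s (A i))" by (rule 4)
  qed
qed

lemma hausdorff_outer_empty [simp]: "hausdorff_outer s {} = 0"
  and hausdorff_outer_mono: "A \<subseteq> B \<Longrightarrow> hausdorff_outer s A \<le> hausdorff_outer s B"
  using outer_measure_space_hausdorff[of s]
  by (auto simp: outer_measure_space_def increasing_def positive_def)

lemma hausdorff_outer_subadd: "hausdorff_outer s (\<Union>i. A i) \<le> (\<Sum>i::nat. hausdorff_outer s (A i))"
proof -
  have *: "countably_subadditive UNIV (hausdorff_outer s :: 'a set \<Rightarrow> ennreal)"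
    using outer_measure_space_hausdorff[of s, where 'a='a] by (simp add: outer_measure_space_def)
  have "hausdorff_outer s (\<Union>i. A i) = hausdorff_outer s (\<Union>i. disjointed A i)"
    by (simp add: UN_disjointed_eq)
  also have "\<dots> \<le> (\<Sum>i. hausdorff_outer s (disjointed A i))"
    using * by (simp add: countably_subadditive_def disjoint_family_disjointed)
  also have "\<dots> \<le> (\<Sum>i. hausdorff_outer s (A i))"
    by (intro suminf_le hausdorff_outer_mono disjointed_subset) auto
  finally show ?thesis .
qed

lemma hausdorff_outer_Un: "hausdorff_outer s (A \<union> B) \<le> hausdorff_outer s A + hausdorff_outer s B"
proof -
  have "hausdorff_outer s (A \<union> B) = hausdorff_outer s (\<Union>i. binaryset A B i)"
    by (simp add: UN_binaryset_eq)
  also have "\<dots> \<le> (\<Sum>i. hausdorff_outer s (binaryset A B i))" by (rule hausdorff_outer_subadd)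
  also have "\<dots> = hausdorff_outer s A + hausdorff_outer s B"
    by (simp add: suminf_binaryset_eq)
  finally show ?thesis .
qed

lemma hausdorff_outer_separated:
  assumes "0 < e" and sep: "\<And>x y. x \<in> A \<Longrightarrow> y \<in> B \<Longrightarrow> e \<le> dist x y"
  shows "hausdorff_outer s A + hausdorff_outer s B \<le> hausdorff_outer s (A \<union> B)"
proof -
  let ?O = "\<lambda>\<delta>. outer_measure UNIV (hausdorff_weight s \<delta> :: 'a set \<Rightarrow> ennreal)"
  have anti: "?O \<epsilon> C \<le> ?O \<delta> C" if "\<delta> \<le> \<epsilon>" for \<delta> \<epsilon> C
    unfolding outer_measure_def
    by (intro INF_mono) (use that in \<open>auto intro!: bexI suminf_le hausdorff_weight_antimono\<close>)
  have key: "?O \<delta> A + ?O \<delta> B \<le> ?O \<delta> (A \<union> B)" if d: "\<delta> < e" for \<delta>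
    unfolding outer_measure_def[of _ _ "A \<union> B"]
  proof (rule INF_greatest)
    fix C assume C: "C \<in> {C. range C \<subseteq> UNIV \<and> disjoint_family C \<and> A \<union> B \<subseteq> (\<Union>i::nat. C i)}"
    have w: "hausdorff_weight s \<delta> (C i \<inter> A) + hausdorff_weight s \<delta> (C i \<inter> B) \<le> hausdorff_weight s \<delta> (C i)" for i
    proof (cases "bounded (C i) \<and> diameter (C i) \<le> \<delta> \<or> C i = {}")
      case True
      have "C i \<inter> A = {} \<or> C i \<inter> B = {}"
      proof (rule ccontr)
        assume "\<not> ?thesis"
        then obtain x y where xy: "x \<in> C i" "x \<in> A" "y \<in> C i" "y \<in> B" by auto
        then have "dist x y \<le> diameter (C i)" using True by (intro diameter_bounded_bound) auto
        with sep[of x y] xy True d show False by auto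
      qed
      moreover have "hausdorff_weight s \<delta> ({} :: 'a set) = 0" by (simp add: hausdorff_weight_def)
      ultimately show ?thesis by (auto intro: hausdorff_weight_mono)
    next
      case False then show ?thesis by (auto simp: hausdorff_weight_def)
    qed
    have O: "?O \<delta> X \<le> (\<Sum>i. hausdorff_weight s \<delta> (C i \<inter> X))" if "X \<subseteq> A \<union> B" for X
      unfolding outer_measure_def
      by (rule INF_lower) (use C that in \<open>auto simp: disjoint_family_on_def\<close>)
    have "?O \<delta> A + ?O \<delta> B \<le> (\<Sum>i. hausdorff_weight s \<delta> (C i \<inter> A)) + (\<Sum>i. hausdorff_weight s \<delta> (C i \<inter> B))"
      by (intro add_mono O) auto
    also have "\<dots> = (\<Sum>i. hausdorff_weight s \<delta> (C i \<inter> A) + hausdorff_weight s \<delta> (C i \<inter> B))"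
      by (rule suminf_add) auto
    also have "\<dots> \<le> (\<Sum>i. hausdorff_weight s \<delta> (C i))" by (intro suminf_le w) auto
    finally show "?O \<delta> A + ?O \<delta> B \<le> (\<Sum>i. hausdorff_weight s \<delta> (C i))" .
  qed
  have "hausdorff_outer s A + hausdorff_outer s B = (SUP \<delta>\<in>{0<..}. ?O \<delta> A + ?O \<delta> B)"
    unfolding hausdorff_outer_def
  proof (rule SUP_add_directed_ennreal[symmetric])
    show "\<exists>k\<in>{0<..}. ?O i A + ?O j B \<le> ?O k A + ?O k B" if "i \<in> {0<..}" "j \<in> {0<..}" for i j
      using that by (intro bexI[of _ "min i j"] add_mono anti) auto
  qed
  also have "\<dots> \<le> hausdorff_outer s (A \<union> B)"
  proof (rule SUP_least)
    fix \<delta> :: real assume d: "\<delta> \<in> {0<..}"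
    let ?d = "min \<delta> (e/2)"
    have "?O \<delta> A + ?O \<delta> B \<le> ?O ?d A + ?O ?d B" by (intro add_mono anti) auto
    also have "\<dots> \<le> ?O ?d (A \<union> B)" using \<open>0 < e\<close> by (intro key) auto
    also have "\<dots> \<le> hausdorff_outer s (A \<union> B)"
      unfolding hausdorff_outer_def using d \<open>0 < e\<close> by (intro SUP_upper) auto
    finally show "?O \<delta> A + ?O \<delta> B \<le> hausdorff_outer s (A \<union> B)" .
  qed
  finally show ?thesis .
qed

lemma infdist_gap: "infdist x F - infdist y F \<le> dist x y"
  using infdist_triangle[of x F y] by simp

lemma hausdorff_shells:
  fixes A F :: "'a::metric_space set"
  defines "D \<equiv> \<lambda>k::nat. {x\<in>A. 1 / (real k + 2) \<le> infdist x F \<and> infdist x F < 1 / (real k + 1)}"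
  shows "(\<Sum>k<n. hausdorff_outer s (D (2*k+p))) \<le> hausdorff_outer s A"
proof -
  have "(\<Sum>k<n. hausdorff_outer s (D (2*k+p))) \<le> hausdorff_outer s (\<Union>k<n. D (2*k+p))"
  proof (induction n)
    case (Suc n)
    have "(\<Sum>k<Suc n. hausdorff_outer s (D (2*k+p)))
        \<le> hausdorff_outer s (\<Union>k<n. D (2*k+p)) + hausdorff_outer s (D (2*n+p))"
      using Suc by (simp add: add_right_mono)
    also have "\<dots> \<le> hausdorff_outer s ((\<Union>k<n. D (2*k+p)) \<union> D (2*n+p))"
    proof (cases "n = 0")
      case False
      define e where "e = 1 / (real (2*n+p)) - 1 / (real (2*n+p) + 1)"
      have "0 < real (2*n+p)" using False by simp
      then have "0 < e" unfolding e_def by (simp add: divide_strict_left_mono del: of_nat_add of_nat_mult)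
      then show ?thesis
      proof (rule hausdorff_outer_separated)
        fix x y assume "x \<in> (\<Union>k<n. D (2*k+p))" and y: "y \<in> D (2*n+p)"
        then obtain k where k: "k < n" "x \<in> D (2*k+p)" by auto
        have "1 / real (2*n+p) \<le> 1 / (real (2*k+p) + 2)"
          using k False by (intro frac_le) auto
        also have "\<dots> \<le> infdist x F" using k by (simp add: D_def)
        finally have "1 / real (2*n+p) \<le> infdist x F" .
        moreover have "infdist y F \<le> 1 / (real (2*n+p) + 1)" using y by (simp add: D_def)
        ultimately show "e \<le> dist x y" using infdist_gap[of x F y] unfolding e_def by linarith
      qed
    qed simp
    also have "(\<Union>k<n. D (2*k+p)) \<union> D (2*n+p) = (\<Union>k<Suc n. D (2*k+p))"
      by (auto simp: lessThan_Suc)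
    finally show ?case .
  qed simp
  also have "\<dots> \<le> hausdorff_outer s A" by (rule hausdorff_outer_mono) (auto simp: D_def)
  finally show ?thesis .
qed

lemma hausdorff_outer_closed:
  fixes A F :: "'a::metric_space set"
  assumes "closed F"
  shows "hausdorff_outer s (A \<inter> F) + hausdorff_outer s (A - F) \<le> hausdorff_outer s A"
proof (cases "F = {} \<or> hausdorff_outer s A = top")
  case True then show ?thesis by (auto simp: top_greatest)
next
  case False
  define D where "D = (\<lambda>k::nat. {x\<in>A. 1 / (real k + 2) \<le> infdist x F \<and> infdist x F < 1 / (real k + 1)})"
  define E where "E = (\<lambda>n::nat. {x\<in>A. 1 / (real n + 1) \<le> infdist x F})"
  let ?H = "hausdorff_outer s"
  have fin: "?H A < top" using False by (simp add: top.not_eq_extremum)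
  have finD: "?H (D k) < top" for k
    using hausdorff_outer_mono[of "D k" A s] fin by (auto simp: D_def intro: le_less_trans)
  define g where "g k = enn2real (?H (D k))" for k
  have Hg: "?H (D k) = ennreal (g k)" for k using finD[of k] by (simp add: g_def)
  have g0: "0 \<le> g k" for k by (simp add: g_def)
  have sub: "(\<Sum>k<n. g (2*k+p)) \<le> enn2real (?H A)" for n p
  proof -
    have "ennreal (\<Sum>k<n. g (2*k+p)) = (\<Sum>k<n. ?H (D (2*k+p)))"
      using g0 by (simp add: Hg sum_ennreal)
    also have "\<dots> \<le> ?H A" unfolding D_def by (rule hausdorff_shells)
    finally show ?thesis using fin g0
      by (metis enn2real_ennreal enn2real_mono sum_nonneg)
  qed
  have tot: "(\<Sum>k<n. g k) \<le> 2 * enn2real (?H A)" for n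
  proof -
    have "(\<Sum>k<n. g k) \<le> (\<Sum>k<2*n. g k)"
      using g0 by (intro sum_mono2) auto
    also have "\<dots> = (\<Sum>k<n. g (2*k+0)) + (\<Sum>k<n. g (2*k+1))"
      by (induction n) auto
    also have "\<dots> \<le> 2 * enn2real (?H A)" using sub[of 0 n] sub[of 1 n] by linarith
    finally show ?thesis .
  qed
  have tot': "(\<Sum>k\<le>n. g k) \<le> 2 * enn2real (?H A)" for n
    using tot[of "Suc n"] by (simp only: lessThan_Suc_atMost)
  have summ: "summable g" using g0 tot' by (rule bounded_imp_summable)
  have cover: "A - F \<subseteq> E n \<union> (\<Union>k. D (k + n))" for n
  proof
    fix x assume x: "x \<in> A - F"
    then have pos: "0 < infdist x F"
      using assms False in_closed_iff_infdist_zero[of F x] infdist_nonneg[of x F] by force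
    show "x \<in> E n \<union> (\<Union>k. D (k + n))"
    proof (cases "1 / (real n + 1) \<le> infdist x F")
      case True then show ?thesis using x by (simp add: E_def)
    next
      case nE: False
      define P where "P j \<longleftrightarrow> 1 / (real j + 1) \<le> infdist x F" for j :: nat
      obtain j0 where "inverse (real (Suc j0)) < infdist x F" using reals_Archimedean[OF pos] by auto
      then have "P j0" by (simp add: P_def inverse_eq_divide add.commute)
      define j where "j = (LEAST j. P j)"
      have Pj: "P j" unfolding j_def using \<open>P j0\<close> by (rule LeastI)
      have "n < j"
      proof (rule ccontr)
        assume "\<not> n < j"
        then have "1 / (real n + 1) \<le> 1 / (real j + 1)" by (intro divide_left_mono) auto
        with Pj nE show False by (simp add: P_def)
      qed
      then obtain i where i: "j = Suc (i + n)" using less_imp_Suc_add[of n j] by (auto simp: add.commute)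
      have "\<not> P (i + n)" using not_less_Least[of "i + n" P] i by (simp add: j_def)
      then have "x \<in> D (i + n)" using Pj x i by (auto simp: D_def P_def add.commute)
      then show ?thesis by blast
    qed
  qed
  have main: "?H (A \<inter> F) + ?H (A - F) \<le> ?H A + ennreal (\<Sum>k. g (k + n))" for n
  proof -
    have "?H (A - F) \<le> ?H (E n) + ?H (\<Union>k. D (k + n))"
      using hausdorff_outer_mono[OF cover[of n], of s] hausdorff_outer_Un[of s "E n" "\<Union>k. D (k + n)"]
      by (rule order_trans)
    also have "?H (\<Union>k. D (k + n)) \<le> (\<Sum>k. ?H (D (k + n)))" by (rule hausdorff_outer_subadd)
    also have "(\<Sum>k. ?H (D (k + n))) = ennreal (\<Sum>k. g (k + n))"
      unfolding Hg using summ g0 by (intro suminf_ennreal2) (auto simp: summable_iff_shift)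
    finally have "?H (A - F) \<le> ?H (E n) + ennreal (\<Sum>k. g (k + n))" by (simp add: add_left_mono)
    then have "?H (A \<inter> F) + ?H (A - F) \<le> ?H (A \<inter> F) + (?H (E n) + ennreal (\<Sum>k. g (k + n)))"
      by (rule add_left_mono)
    also have "\<dots> = (?H (A \<inter> F) + ?H (E n)) + ennreal (\<Sum>k. g (k + n))" by (simp add: add.assoc)
    also have "?H (A \<inter> F) + ?H (E n) \<le> ?H (A \<inter> F \<union> E n)"
    proof (rule hausdorff_outer_separated)
      show "0 < 1 / (real n + 1)" by simp
      fix x y assume "x \<in> A \<inter> F" "y \<in> E n"
      then show "1 / (real n + 1) \<le> dist x y"
        using infdist_gap[of y F x] by (auto simp: E_def dist_commute)
    qed
    also have "\<dots> \<le> ?H A" by (rule hausdorff_outer_mono) (auto simp: E_def)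
    finally show ?thesis by (simp add: add_right_mono)
  qed
  show ?thesis
  proof (rule ennreal_le_epsilon)
    fix e :: real assume "0 < e"
    then obtain n where "norm (\<Sum>k. g (k + n)) < e" using suminf_exist_split[OF _ summ] by blast
    then have "ennreal (\<Sum>k. g (k + n)) \<le> ennreal e" by (intro ennreal_leI) auto
    then show "?H (A \<inter> F) + ?H (A - F) \<le> ?H A + ennreal e"
      using main[of n] add_left_mono order_trans by blast
  qed
qed

lemma measure_space_hausdorff: "measure_space UNIV (sets borel) (hausdorff_outer s :: 'a::metric_space set \<Rightarrow> ennreal)"
proof -
  let ?L = "lambda_system UNIV UNIV (hausdorff_outer s :: 'a set \<Rightarrow> ennreal)"
  interpret P: sigma_algebra "UNIV :: 'a set" UNIV
    using sigma_algebra_Pow[of "UNIV :: 'a set"] by simp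
  have ms: "measure_space UNIV ?L (hausdorff_outer s)"
    by (rule P.caratheodory_lemma[OF outer_measure_space_hausdorff])
  then interpret L: sigma_algebra UNIV ?L by (simp add: measure_space_def)
  have cl: "F \<in> ?L" if "closed F" for F
    unfolding P.lambda_system_eq
  proof (safe intro!: antisym)
    fix x
    show "hausdorff_outer s (x \<inter> F) + hausdorff_outer s (x - F) \<le> hausdorff_outer s x"
      using that by (rule hausdorff_outer_closed)
    show "hausdorff_outer s x \<le> hausdorff_outer s (x \<inter> F) + hausdorff_outer s (x - F)"
      using hausdorff_outer_Un[of s "x \<inter> F" "x - F"] by (simp add: Int_Diff_Un)
  qed auto
  have "sets (borel :: 'a measure) = sigma_sets UNIV (Collect closed)"
    by (simp add: borel_eq_closed)
  also have "\<dots> \<subseteq> ?L" using cl by (intro L.sigma_sets_subset) auto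
  finally have sub: "sets (borel :: 'a measure) \<subseteq> ?L" .
  have "sigma_algebra UNIV (sets (borel :: 'a measure))"
    using sets.sigma_algebra_axioms[of "borel :: 'a measure"] by simp
  then show ?thesis
    using ms sub unfolding measure_space_def positive_def countably_additive_def by auto
qed

lemma space_hausdorff_measure [simp]: "space (hausdorff_measure s) = UNIV"
  and sets_hausdorff_measure [simp, measurable_cong]: "sets (hausdorff_measure s) = sets borel"
  by (simp_all add: hausdorff_measure_def space_measure_of_conv sets_measure_of_conv
        sets.sigma_sets_eq[of borel, simplified])

lemma emeasure_hausdorff_measure:
  assumes "A \<in> sets borel"
  shows "emeasure (hausdorff_measure s) A = hausdorff_outer s A"
  unfolding hausdorff_measure_def
proof (rule emeasure_measure_of_sigma)
  show "sigma_algebra UNIV (sets borel :: 'a set set)"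
    and "positive (sets borel) (hausdorff_outer s :: 'a set \<Rightarrow> ennreal)"
    and "countably_additive (sets borel) (hausdorff_outer s :: 'a set \<Rightarrow> ennreal)"
    using measure_space_hausdorff[of s, where 'a='a] by (simp_all add: measure_space_def)
qed fact

section \<open>Function spaces and operators\<close>

text \<open>A Banach space of functions on \<open>\<Omega>\<close>: the carrier \<open>U\<close> consists of representatives
  (their values outside \<open>\<Omega>\<close> are irrelevant), and two of them are the same element exactly if
  they agree almost everywhere on \<open>\<Omega>\<close>.\<close>

definition banach_function_space ::
    "'a::euclidean_space set \<Rightarrow> ('a \<Rightarrow> real) set \<Rightarrow> (('a \<Rightarrow> real) \<Rightarrow> real) \<Rightarrow> bool" where
  "banach_function_space \<Omega> U nrm \<longleftrightarrow>
     (\<lambda>x. 0) \<in> U \<and>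
     (\<forall>f\<in>U. \<forall>g\<in>U. (\<lambda>x. f x + g x) \<in> U) \<and>
     (\<forall>c. \<forall>f\<in>U. (\<lambda>x. c * f x) \<in> U) \<and>
     (\<forall>f\<in>U. 0 \<le> nrm f) \<and>
     (\<forall>f\<in>U. nrm f = 0 \<longleftrightarrow> (AE x in lebesgue. x \<in> \<Omega> \<longrightarrow> f x = 0)) \<and>
     (\<forall>f\<in>U. \<forall>g\<in>U. nrm (\<lambda>x. f x + g x) \<le> nrm f + nrm g) \<and>
     (\<forall>c. \<forall>f\<in>U. nrm (\<lambda>x. c * f x) = \<bar>c\<bar> * nrm f) \<and>
     (\<forall>F::nat \<Rightarrow> 'a \<Rightarrow> real.
        (\<forall>n. F n \<in> U) \<and> (\<forall>e>0. \<exists>K. \<forall>m\<ge>K. \<forall>n\<ge>K. nrm (\<lambda>x. F m x - F n x) < e) \<longrightarrow>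
        (\<exists>f\<in>U. (\<lambda>n. nrm (\<lambda>x. F n x - f x)) \<longlonglongrightarrow> 0))"

text \<open>Bounded linear operators from \<open>U\<close> into \<open>C(S)\<close>. The seminorms of \<open>C(S)\<close> are the suprema over
  compact subsets of \<open>S\<close>; for compact \<open>S\<close> this is boundedness in the supremum norm, and
  boundedness in the supremum norm implies it for every \<open>S\<close>.\<close>

definition bounded_linear_to_C ::
    "('a::euclidean_space \<Rightarrow> real) set \<Rightarrow> (('a \<Rightarrow> real) \<Rightarrow> real) \<Rightarrow> 'a set \<Rightarrow>
     (('a \<Rightarrow> real) \<Rightarrow> 'a \<Rightarrow> real) \<Rightarrow> bool" where
  "bounded_linear_to_C U nrm S L \<longleftrightarrow>
     (\<forall>f\<in>U. continuous_on S (L f)) \<and>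
     (\<forall>f\<in>U. \<forall>g\<in>U. \<forall>x\<in>S. L (\<lambda>y. f y + g y) x = L f x + L g x) \<and>
     (\<forall>c. \<forall>f\<in>U. \<forall>x\<in>S. L (\<lambda>y. c * f y) x = c * L f x) \<and>
     (\<forall>K. compact K \<and> K \<subseteq> S \<longrightarrow> (\<exists>C. \<forall>f\<in>U. \<forall>x\<in>K. \<bar>L f x\<bar> \<le> C * nrm f))"

text \<open>The point of \<^term>\<open>Euclidean_space n\<close> (sequences vanishing from index \<open>n\<close> on) with
  coordinates \<open>a (k + 1), \<dots>, a (k + n)\<close>.\<close>

definition vec_from :: "nat \<Rightarrow> nat \<Rightarrow> (nat \<Rightarrow> real) \<Rightarrow> nat \<Rightarrow> real" where
  "vec_from k n a = (\<lambda>i. if i < n then a (k + 1 + i) else 0)"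

definition structural_assumption ::
    "'a::euclidean_space set \<Rightarrow>
     ('a \<Rightarrow> real) set \<Rightarrow> (('a \<Rightarrow> real) \<Rightarrow> real) \<Rightarrow>
     ('a \<Rightarrow> real) set \<Rightarrow> (('a \<Rightarrow> real) \<Rightarrow> real) \<Rightarrow>
     (('a \<Rightarrow> real) \<Rightarrow> ('a \<Rightarrow> real) \<Rightarrow> real \<Rightarrow> 'a \<Rightarrow> 'p::euclidean_space) \<Rightarrow>
     (('a \<Rightarrow> real) \<Rightarrow> ('a \<Rightarrow> real) \<Rightarrow> 'a \<Rightarrow> 'b::euclidean_space) \<Rightarrow> bool" where
  "structural_assumption \<Omega> U nU V nV \<P> \<B> \<longleftrightarrow>
     (\<exists>Q Qb D Db L J
        (P :: (nat \<Rightarrow> real) \<times> (nat \<Rightarrow> real) \<times> real \<Rightarrow> 'p)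
        (B :: (nat \<Rightarrow> real) \<times> (nat \<Rightarrow> real) \<Rightarrow> 'b).
        1 \<le> Qb \<and> Qb \<le> Q \<and> 1 \<le> Db \<and> Db \<le> D \<and>
        (\<forall>q\<in>{1..Qb}. bounded_linear_to_C U nU (frontier \<Omega>) (L q)) \<and>
        (\<forall>q\<in>{Qb+1..Q}. bounded_linear_to_C U nU (interior \<Omega>) (L q)) \<and>
        (\<forall>j\<in>{1..Db}. bounded_linear_to_C V nV (frontier \<Omega>) (J j)) \<and>
        (\<forall>j\<in>{Db+1..D}. bounded_linear_to_C V nV (interior \<Omega>) (J j)) \<and>
        continuous_map
          (prod_topology (Euclidean_space (Q - Qb)) (prod_topology (Euclidean_space (D - Db)) euclidean))
          euclidean P \<and>
        continuous_map
          (prod_topology (Euclidean_space Qb) (Euclidean_space Db)) euclidean B \<and>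
        (\<forall>u\<in>U. \<forall>m\<in>V. \<forall>H. \<forall>x\<in>interior \<Omega>.
           \<P> u m H x = P (vec_from Qb (Q - Qb) (\<lambda>q. L q u x), vec_from Db (D - Db) (\<lambda>j. J j m x), H)) \<and>
        (\<forall>u\<in>U. \<forall>m\<in>V. \<forall>x\<in>frontier \<Omega>.
           \<B> u m x = B (vec_from 0 Qb (\<lambda>q. L q u x), vec_from 0 Db (\<lambda>j. J j m x))))"

section \<open>Fourier features spaces and the objective\<close>

definition feature_space :: "('a \<Rightarrow> 'w \<Rightarrow> real) \<Rightarrow> nat \<Rightarrow> (nat \<Rightarrow> 'w) \<Rightarrow> ('a \<Rightarrow> real) set" where
  "feature_space \<zeta> N \<omega> = {u. \<exists>\<alpha>. u = (\<lambda>x. \<Sum>i\<in>{1..N}. \<alpha> i * \<zeta> x (\<omega> i))}"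

definition L2_norm_sq :: "'a measure \<Rightarrow> 'a set \<Rightarrow> ('a \<Rightarrow> 'b::real_normed_vector) \<Rightarrow> ennreal" where
  "L2_norm_sq M S f = (\<integral>\<^sup>+x\<in>S. ennreal ((norm (f x))\<^sup>2) \<partial>M)"

text \<open>The objective takes values in \<open>[0, \<infinity>]\<close>, so that no square integrability of \<open>\<P>(u, m, H)\<close>
  and \<open>\<B>(u, m)\<close> needs to be imposed. Since \<open>\<P>(u, m, H)\<close> is a function on \<open>int \<Omega>\<close> (nothing is
  prescribed about it on \<open>\<partial>\<Omega>\<close>), its \<open>L\<^sup>2\<close> norm is taken there.\<close>

definition objective ::
    "'a::euclidean_space set \<Rightarrow>
     (('a \<Rightarrow> real) \<Rightarrow> ('a \<Rightarrow> real) \<Rightarrow> real \<Rightarrow> 'a \<Rightarrow> 'p::euclidean_space) \<Rightarrow>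
     (('a \<Rightarrow> real) \<Rightarrow> ('a \<Rightarrow> real) \<Rightarrow> 'a \<Rightarrow> 'b::euclidean_space) \<Rightarrow>
     real \<Rightarrow> ('a \<Rightarrow> real) \<Rightarrow> ('a \<Rightarrow> real) \<Rightarrow> real \<Rightarrow> ennreal" where
  "objective \<Omega> \<P> \<B> \<gamma> u m H =
     L2_norm_sq lebesgue \<Omega> u + L2_norm_sq lebesgue \<Omega> m + ennreal (\<bar>H\<bar>\<^sup>2)
     + ennreal \<gamma> * L2_norm_sq lebesgue (interior \<Omega>) (\<P> u m H)
     + ennreal \<gamma> * L2_norm_sq (hausdorff_measure (DIM('a) - 1)) (frontier \<Omega>) (\<B> u m)
     + ennreal (\<gamma> * \<bar>(LINT x:\<Omega>|lebesgue. m x) - 1\<bar>\<^sup>2)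
     + ennreal (\<gamma> * \<bar>LINT x:\<Omega>|lebesgue. u x\<bar>\<^sup>2)"

end

theory Submission
  imports Defs
begin

text \<open>The existence proof is the direct method in the finitely many coefficients, with two
  obstacles. The objective takes values in \<open>[0, \<infinity>]\<close>, because \<open>\<P>(u, m, H)\<close> and \<open>\<B>(u, m)\<close> need not
  be square integrable, so it is in general only lower semicontinuous. And the features may be
  linearly dependent up to null sets, so a minimising sequence may have unbounded coefficients.

  Lower semicontinuity comes from Fatou's lemma (\<open>L2_norm_sq_le_liminf\<close>): if coefficients and
  \<open>H\<close> converge, then every \<open>L q u x\<close> and \<open>J j m x\<close> converges, being a finite linear combination of
  the values on the features, and continuity of \<open>P\<close> and \<open>B\<close> gives pointwise convergence of the
  integrands (\<open>nemytskii_operator_lincomb_tendsto\<close>). The three remaining terms are continuous.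

  For compactness, a smallest set of feature indices is chosen that still yields every element of
  the feature space up to a null set (\<open>exists_independent_spanning_AE\<close>). On these indices a bound
  on the \<open>L\<^sup>2\<close> norm bounds the coefficients (\<open>L2_sublevel_coefficients_bounded\<close>), and the first
  three terms of the objective provide this bound together with one on \<open>H\<close>. Hence the restricted
  problem has a minimiser (\<open>coercive_lsc_attains_min\<close>).

  The minimiser is one of the whole problem, since the objective depends only on the almost
  everywhere classes of \<open>u\<close> and \<open>m\<close> (\<open>objective_cong_AE\<close>). This is not obvious for the boundary
  term, as \<open>\<partial>\<Omega>\<close> may be a null set. It holds because the difference of two representatives has
  norm zero, so that the bounded operators \<open>L q\<close>, \<open>J j\<close> send it to zero at every point.\<close>

section \<open>Lower semicontinuity\<close>

lemma liminf_add_ge: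
  fixes f g :: "nat \<Rightarrow> ennreal"
  shows "liminf f + liminf g \<le> liminf (\<lambda>n. f n + g n)"
proof -
  have inc: "incseq (\<lambda>n. INF m\<in>{n..}. h m)" for h :: "nat \<Rightarrow> ennreal"
    by (intro incseq_SucI INF_superset_mono) auto
  have "liminf f + liminf g = (SUP n. (INF m\<in>{n..}. f m) + (INF m\<in>{n..}. g m))"
    unfolding liminf_SUP_INF by (rule ennreal_SUP_add[symmetric]) (rule inc)+
  also have "\<dots> \<le> (SUP n. INF m\<in>{n..}. f m + g m)"
    by (intro SUP_mono') (intro INF_greatest add_mono INF_lower; simp)
  finally show ?thesis by (simp add: liminf_SUP_INF)
qed

lemma liminf_cmult_ge:
  fixes f :: "nat \<Rightarrow> ennreal"
  shows "c * liminf f \<le> liminf (\<lambda>n. c * f n)"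
proof -
  have "c * liminf f = (SUP n. c * (INF m\<in>{n..}. f m))"
    unfolding liminf_SUP_INF by (rule SUP_mult_left_ennreal)
  also have "\<dots> \<le> (SUP n. INF m\<in>{n..}. c * f m)"
    by (intro SUP_mono') (intro INF_greatest mult_left_mono INF_lower; simp)
  finally show ?thesis by (simp add: liminf_SUP_INF)
qed

lemma le_liminf_tendsto:
  fixes f :: "nat \<Rightarrow> ennreal"
  assumes "f \<longlonglongrightarrow> l" shows "l \<le> liminf f"
  using assms by (simp add: lim_imp_Liminf)

lemma L2_norm_sq_indicator:
  "L2_norm_sq M S f = (\<integral>\<^sup>+x. ennreal ((norm (indicator S x *\<^sub>R f x))\<^sup>2) \<partial>M)"
  unfolding L2_norm_sq_def by (intro nn_integral_cong) (auto simp: indicator_def)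

text \<open>Fatou's lemma. Values in \<open>[0, \<infinity>]\<close> allow functions that are not square integrable.\<close>

lemma L2_norm_sq_le_liminf:
  fixes f :: "nat \<Rightarrow> 'a \<Rightarrow> 'b::euclidean_space"
  assumes meas: "\<And>n. set_borel_measurable M S (f n)"
    and lim: "\<And>x. x \<in> S \<Longrightarrow> (\<lambda>n. f n x) \<longlonglongrightarrow> g x"
  shows "L2_norm_sq M S g \<le> liminf (\<lambda>n. L2_norm_sq M S (f n))"
proof -
  have "L2_norm_sq M S g = (\<integral>\<^sup>+x. liminf (\<lambda>n. ennreal ((norm (indicator S x *\<^sub>R f n x))\<^sup>2)) \<partial>M)"
    unfolding L2_norm_sq_indicator
  proof (rule nn_integral_cong)
    fix x
    have "(\<lambda>n. indicator S x *\<^sub>R f n x) \<longlonglongrightarrow> indicator S x *\<^sub>R g x"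
      by (cases "x \<in> S") (simp_all add: lim)
    then have "(\<lambda>n. ennreal ((norm (indicator S x *\<^sub>R f n x))\<^sup>2)) \<longlonglongrightarrow>
        ennreal ((norm (indicator S x *\<^sub>R g x))\<^sup>2)"
      by (intro tendsto_ennrealI tendsto_power tendsto_norm)
    then show "ennreal ((norm (indicator S x *\<^sub>R g x))\<^sup>2) =
        liminf (\<lambda>n. ennreal ((norm (indicator S x *\<^sub>R f n x))\<^sup>2))"
      by (rule lim_imp_Liminf[OF sequentially_bot, symmetric])
  qed
  also have "\<dots> \<le> liminf (\<lambda>n. L2_norm_sq M S (f n))"
    unfolding L2_norm_sq_indicator
  proof (rule nn_integral_liminf)
    fix n
    have [measurable]: "(\<lambda>x. indicator S x *\<^sub>R f n x) \<in> borel_measurable M"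
      using meas[of n] by (simp add: set_borel_measurable_def)
    show "(\<lambda>x. ennreal ((norm (indicator S x *\<^sub>R f n x))\<^sup>2)) \<in> borel_measurable M"
      by measurable
  qed
  finally show ?thesis .
qed

lemma L2_norm_sq_cong_AE:
  assumes "AE x in M. x \<in> S \<longrightarrow> f x = g x"
  shows "L2_norm_sq M S f = L2_norm_sq M S g"
  unfolding L2_norm_sq_def using assms
  by (intro nn_integral_cong_AE) (auto elim!: eventually_mono simp: indicator_def)

text \<open>The direct method: a minimising sequence eventually stays in a compact set, and the limit
  of a convergent subsequence is a minimiser. If the infimum is \<open>\<infinity>\<close>, every point is one.\<close>

lemma coercive_lsc_attains_min:
  fixes F :: "'a::metric_space \<Rightarrow> ennreal"
  assumes "A \<noteq> {}"
    and coercive: "\<And>c. c < top \<Longrightarrow> \<exists>K. compact K \<and> {x\<in>A. F x \<le> c} \<subseteq> K"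
    and lsc: "\<And>s l. (\<And>n. s n \<in> A) \<Longrightarrow> s \<longlonglongrightarrow> l \<Longrightarrow> l \<in> A \<and> F l \<le> liminf (\<lambda>n. F (s n))"
  shows "\<exists>x\<in>A. \<forall>y\<in>A. F x \<le> F y"
proof (cases "Inf (F ` A) = top")
  case True
  then have "F y = top" if "y \<in> A" for y
    using that INF_lower[of y A F] by (simp add: top_unique)
  then show ?thesis using assms(1) by auto
next
  case False
  then have "Inf (F ` A) < top" by (simp only: top.not_eq_extremum)
  from dense[OF this] obtain c where c: "Inf (F ` A) < c" "c < top"
    by auto
  have "F ` A \<noteq> {}" using assms(1) by simp
  from Inf_as_limit[OF this]
  obtain v where v: "\<And>n. v n \<in> F ` A" "v \<longlonglongrightarrow> Inf (F ` A)"
    by auto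
  have "\<forall>n. \<exists>x. x \<in> A \<and> v n = F x" using v(1) by fast
  then obtain s where s: "\<And>n. s n \<in> A" "\<And>n. v n = F (s n)"
    by metis
  have "eventually (\<lambda>n. v n < c) sequentially"
    using v(2) c(1) by (rule order_tendstoD)
  then obtain n0 where n0: "\<And>n. n \<ge> n0 \<Longrightarrow> v n < c"
    by (auto simp: eventually_sequentially)
  obtain K where K: "compact K" "{x\<in>A. F x \<le> c} \<subseteq> K"
    using coercive[OF c(2)] by blast
  have "s (n + n0) \<in> K" for n
    using K(2) s(1)[of "n + n0"] s(2)[of "n + n0"] n0[of "n + n0"] by auto
  then obtain l r where r: "strict_mono r" "((\<lambda>n. s (n + n0)) \<circ> r) \<longlonglongrightarrow> l"
    using seq_compactE[OF compact_imp_seq_compact[OF K(1)], of "\<lambda>n. s (n + n0)"] by blast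
  have l: "l \<in> A" "F l \<le> liminf (\<lambda>n. F (s (r n + n0)))"
    using lsc[of "\<lambda>n. s (r n + n0)" l] r(2) s(1) by (auto simp: o_def)
  have "(\<lambda>n. v (n + n0)) \<longlonglongrightarrow> Inf (F ` A)"
    using v(2) by (rule LIMSEQ_ignore_initial_segment)
  from LIMSEQ_subseq_LIMSEQ[OF this r(1)]
  have "(\<lambda>n. F (s (r n + n0))) \<longlonglongrightarrow> Inf (F ` A)"
    by (simp add: o_def s(2))
  then have "liminf (\<lambda>n. F (s (r n + n0))) = Inf (F ` A)"
    by (intro lim_imp_Liminf) auto
  then have "F l \<le> F y" if "y \<in> A" for y
    using l(2) INF_lower[OF that, of F] by simp
  then show ?thesis
    using l(1) by blast
qed

section \<open>Linear combinations modulo null functions\<close>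

definition lincomb :: "('i \<Rightarrow> 'a \<Rightarrow> real) \<Rightarrow> 'i set \<Rightarrow> ('i \<Rightarrow> real) \<Rightarrow> 'a \<Rightarrow> real" where
  "lincomb e A \<alpha> x = (\<Sum>i\<in>A. \<alpha> i * e i x)"

text \<open>Restricting to a subfamily of features is encoded by coefficients that vanish off its index
  set. The coefficients thus remain total functions, which form a metric space under pointwise
  convergence for countable index types, and the sum over all of \<open>A\<close> is kept.\<close>

definition supported_on :: "'i set \<Rightarrow> ('i \<Rightarrow> real) set" where
  "supported_on I = {\<alpha>. \<forall>i. i \<notin> I \<longrightarrow> \<alpha> i = 0}"

definition independent_AE :: "'a measure \<Rightarrow> 'a set \<Rightarrow> ('i \<Rightarrow> 'a \<Rightarrow> real) \<Rightarrow> 'i set \<Rightarrow> 'i set \<Rightarrow> bool" where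
  "independent_AE M S e A I \<longleftrightarrow>
     (\<forall>\<alpha>\<in>supported_on I. (AE x in M. x \<in> S \<longrightarrow> lincomb e A \<alpha> x = 0) \<longrightarrow> \<alpha> = (\<lambda>i. 0))"

definition spanning_AE :: "'a measure \<Rightarrow> 'a set \<Rightarrow> ('i \<Rightarrow> 'a \<Rightarrow> real) \<Rightarrow> 'i set \<Rightarrow> 'i set \<Rightarrow> bool" where
  "spanning_AE M S e A I \<longleftrightarrow>
     (\<forall>\<alpha>. \<exists>\<beta>\<in>supported_on I. AE x in M. x \<in> S \<longrightarrow> lincomb e A \<alpha> x = lincomb e A \<beta> x)"

lemma lincomb_diff_scale:
  "lincomb e A (\<lambda>i. \<alpha> i - c * \<beta> i) x = lincomb e A \<alpha> x - c * lincomb e A \<beta> x"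
  by (simp add: lincomb_def algebra_simps sum_subtractf sum_distrib_left)

lemma lincomb_scale: "lincomb e A (\<lambda>i. c * \<alpha> i) x = c * lincomb e A \<alpha> x"
  by (simp add: lincomb_def sum_distrib_left algebra_simps)

lemma lincomb_tendsto:
  assumes "\<And>i. i \<in> A \<Longrightarrow> ((\<lambda>n. \<alpha> n i) \<longlongrightarrow> \<beta> i) F"
  shows "((\<lambda>n. lincomb e A (\<alpha> n) x) \<longlongrightarrow> lincomb e A \<beta> x) F"
  unfolding lincomb_def by (intro tendsto_intros assms)

lemma supported_on_closed:
  assumes "\<And>n. \<alpha> n \<in> supported_on I" "\<And>i. (\<lambda>n::nat. \<alpha> n i) \<longlonglongrightarrow> \<beta> i"
  shows "\<beta> \<in> supported_on I"
proof -
  have "\<beta> i = 0" if "i \<notin> I" for i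
  proof -
    have "\<alpha> n i = 0" for n using assms(1)[of n] that by (simp add: supported_on_def)
    then show ?thesis using assms(2)[of i] by (simp add: LIMSEQ_const_iff)
  qed
  then show ?thesis by (simp add: supported_on_def)
qed

text \<open>A spanning index set of least cardinality is independent: from a nontrivial relation one
  index could be eliminated.\<close>

lemma exists_independent_spanning_AE:
  assumes "finite A"
  obtains I where "I \<subseteq> A" "independent_AE M S e A I" "spanning_AE M S e A I"
proof -
  define Sp where "Sp = {I. I \<subseteq> A \<and> spanning_AE M S e A I}"
  have "spanning_AE M S e A A"
    unfolding spanning_AE_def
  proof
    fix \<alpha> :: "'a \<Rightarrow> real"
    show "\<exists>\<beta>\<in>supported_on A. AE x in M. x \<in> S \<longrightarrow> lincomb e A \<alpha> x = lincomb e A \<beta> x"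
      by (rule bexI[of _ "\<lambda>i. if i \<in> A then \<alpha> i else 0"]) (auto simp: lincomb_def supported_on_def)
  qed
  then have "A \<in> Sp" by (simp add: Sp_def)
  then obtain I where I: "I \<in> Sp" "\<And>J. J \<in> Sp \<Longrightarrow> card I \<le> card J"
    using ex_has_least_nat[of "\<lambda>I. I \<in> Sp" A card] by blast
  then have "I \<subseteq> A" and sp: "spanning_AE M S e A I" by (auto simp: Sp_def)
  have "independent_AE M S e A I"
    unfolding independent_AE_def
  proof (intro ballI impI, rule ccontr)
    fix \<alpha> assume \<alpha>: "\<alpha> \<in> supported_on I" "AE x in M. x \<in> S \<longrightarrow> lincomb e A \<alpha> x = 0"
      and "\<alpha> \<noteq> (\<lambda>i. 0)"
    then obtain j where j: "\<alpha> j \<noteq> 0" by auto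
    then have "j \<in> I" using \<alpha>(1) by (auto simp: supported_on_def)
    have "spanning_AE M S e A (I - {j})"
      unfolding spanning_AE_def
    proof
      fix \<beta>
      obtain \<beta>' where \<beta>': "\<beta>' \<in> supported_on I"
        "AE x in M. x \<in> S \<longrightarrow> lincomb e A \<beta> x = lincomb e A \<beta>' x"
        using sp by (auto simp: spanning_AE_def)
      \<comment> \<open>Subtracting this multiple of the relation removes the coefficient at \<open>j\<close>.\<close>
      define c where "c = \<beta>' j / \<alpha> j"
      show "\<exists>\<beta>'\<in>supported_on (I - {j}). AE x in M. x \<in> S \<longrightarrow> lincomb e A \<beta> x = lincomb e A \<beta>' x"
      proof (rule bexI[of _ "\<lambda>i. \<beta>' i - c * \<alpha> i"])
        show "(\<lambda>i. \<beta>' i - c * \<alpha> i) \<in> supported_on (I - {j})"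
          using \<alpha>(1) \<beta>'(1) j by (auto simp: supported_on_def c_def)
        show "AE x in M. x \<in> S \<longrightarrow> lincomb e A \<beta> x = lincomb e A (\<lambda>i. \<beta>' i - c * \<alpha> i) x"
          using \<alpha>(2) \<beta>'(2) by eventually_elim (auto simp: lincomb_diff_scale)
      qed
    qed
    then have "I - {j} \<in> Sp" using \<open>I \<subseteq> A\<close> by (auto simp: Sp_def)
    then have "card I \<le> card (I - {j})" by (rule I(2))
    moreover have "card (I - {j}) < card I"
      using \<open>j \<in> I\<close> \<open>I \<subseteq> A\<close> assms by (meson card_Diff1_less finite_subset)
    ultimately show False by simp
  qed
  with \<open>I \<subseteq> A\<close> sp that show thesis by blast
qed

text \<open>The topology on functions is the product topology, so the abstract characterisation of limits
  applies.\<close>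

lemma tendsto_fun_componentwise:
  fixes f :: "'c \<Rightarrow> 'i \<Rightarrow> 'b::topological_space"
  shows "(f \<longlongrightarrow> l) F \<longleftrightarrow> (\<forall>i. ((\<lambda>n. f n i) \<longlongrightarrow> l i) F)"
proof -
  have "(f \<longlongrightarrow> l) F \<longleftrightarrow> limitin (product_topology (\<lambda>i. euclidean) UNIV) f l F"
    by (simp add: euclidean_product_topology)
  then show ?thesis by (simp add: limitin_componentwise)
qed

text \<open>By Tychonoff's theorem.\<close>

lemma compact_box_fun: "compact {\<alpha> :: 'i \<Rightarrow> real. \<forall>i. \<bar>\<alpha> i\<bar> \<le> C}"
proof -
  have "{\<alpha> :: 'i \<Rightarrow> real. \<forall>i. \<bar>\<alpha> i\<bar> \<le> C} = PiE UNIV (\<lambda>i. {-C..C})"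
    by (auto simp: PiE_def Pi_def abs_le_iff intro: le_imp_neg_le) (metis minus_le_iff)+
  moreover have "compactin (product_topology (\<lambda>i::'i. euclidean :: real topology) UNIV) (PiE UNIV (\<lambda>i. {-C..C}))"
    unfolding compactin_PiE by simp
  ultimately show ?thesis
    by (simp add: euclidean_product_topology)
qed

lemma L2_norm_sq_scale:
  assumes "set_borel_measurable M S f"
  shows "L2_norm_sq M S (\<lambda>x. c * f x :: real) = ennreal (c\<^sup>2) * L2_norm_sq M S f"
proof -
  have "L2_norm_sq M S (\<lambda>x. c * f x) =
      (\<integral>\<^sup>+x. ennreal (c\<^sup>2) * ennreal ((norm (indicator S x *\<^sub>R f x))\<^sup>2) \<partial>M)"
    unfolding L2_norm_sq_indicator
  proof (rule nn_integral_cong)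
    fix x
    have "(norm (indicator S x *\<^sub>R (c * f x)))\<^sup>2 = c\<^sup>2 * (norm (indicator S x *\<^sub>R f x))\<^sup>2"
      by (simp add: power_mult_distrib)
    then show "ennreal ((norm (indicator S x *\<^sub>R (c * f x)))\<^sup>2) =
        ennreal (c\<^sup>2) * ennreal ((norm (indicator S x *\<^sub>R f x))\<^sup>2)"
      by (simp only: ennreal_mult zero_le_power2)
  qed
  also have "\<dots> = ennreal (c\<^sup>2) * L2_norm_sq M S f"
    unfolding L2_norm_sq_indicator
    using assms by (intro nn_integral_cmult) (simp add: set_borel_measurable_def)
  finally show ?thesis .
qed

lemma set_borel_measurable_lincomb:
  assumes "\<And>i. i \<in> A \<Longrightarrow> set_borel_measurable M S (e i)"
  shows "set_borel_measurable M S (lincomb e A \<alpha>)"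
proof -
  have "(\<lambda>x. indicator S x *\<^sub>R lincomb e A \<alpha> x) = (\<lambda>x. \<Sum>i\<in>A. \<alpha> i * (indicator S x *\<^sub>R e i x))"
    by (simp add: lincomb_def sum_distrib_left algebra_simps)
  then show ?thesis
    using assms by (simp add: set_borel_measurable_def)
qed

text \<open>Otherwise there are coefficients of arbitrarily large \<open>l\<^sup>1\<close> norm with bounded \<open>L\<^sup>2\<close> norm of the
  combination. Scaled to \<open>l\<^sup>1\<close> norm one, they have a subsequential limit of \<open>l\<^sup>1\<close> norm one, whose
  combination has \<open>L\<^sup>2\<close> norm zero by Fatou's lemma; this contradicts independence.\<close>

lemma L2_sublevel_coefficients_bounded:
  fixes e :: "'i::countable \<Rightarrow> 'a \<Rightarrow> real"
  assumes "finite A" "I \<subseteq> A"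
    and meas: "\<And>i. i \<in> A \<Longrightarrow> set_borel_measurable M S (e i)"
    and ind: "independent_AE M S e A I"
    and c: "c < top"
  shows "\<exists>C. \<forall>\<alpha>\<in>supported_on I. L2_norm_sq M S (lincomb e A \<alpha>) \<le> c \<longrightarrow> (\<forall>i. \<bar>\<alpha> i\<bar> \<le> C)"
proof (rule ccontr)
  assume neg: "\<not> ?thesis"
  have "\<exists>\<alpha>\<in>supported_on I. L2_norm_sq M S (lincomb e A \<alpha>) \<le> c \<and> (\<exists>i. real n + 1 < \<bar>\<alpha> i\<bar>)" for n :: nat
    using neg by (meson not_le)
  then obtain \<alpha> where \<alpha>: "\<And>n. \<alpha> n \<in> supported_on I" "\<And>n. L2_norm_sq M S (lincomb e A (\<alpha> n)) \<le> c"
    "\<And>n. \<exists>i. real n + 1 < \<bar>\<alpha> n i\<bar>"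
    by metis
  define r where "r n = (\<Sum>i\<in>A. \<bar>\<alpha> n i\<bar>)" for n
  have le_r: "\<bar>\<alpha> n i\<bar> \<le> r n" for n i
  proof (cases "i \<in> A")
    case True then show ?thesis unfolding r_def using assms(1) by (intro member_le_sum) auto
  next
    case False
    then have "\<alpha> n i = 0" using \<alpha>(1)[of n] assms(2) by (auto simp: supported_on_def)
    then show ?thesis by (simp add: r_def sum_nonneg)
  qed
  have r_gt: "real n + 1 < r n" for n
    using \<alpha>(3)[of n] le_r less_le_trans by blast
  then have r0: "0 < r n" for n by (smt (verit) of_nat_0_le_iff)
  define b where "b n = (\<lambda>i. (1 / r n) * \<alpha> n i)" for n
  have "b n \<in> {\<beta>. \<forall>i. \<bar>\<beta> i\<bar> \<le> 1}" for n
    using le_r[of n] r0[of n] by (simp add: b_def abs_mult field_simps)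
  then obtain \<beta> k where k: "strict_mono k" "(b \<circ> k) \<longlonglongrightarrow> \<beta>"
    using seq_compactE[OF compact_imp_seq_compact[OF compact_box_fun[of 1]], of b] by blast
  have lim: "(\<lambda>n. b (k n) i) \<longlonglongrightarrow> \<beta> i" for i
    using k(2) by (simp add: tendsto_fun_componentwise)
  have "b n \<in> supported_on I" for n
    using \<alpha>(1)[of n] by (simp add: b_def supported_on_def)
  then have \<beta>I: "\<beta> \<in> supported_on I"
    by (rule supported_on_closed[of "\<lambda>n. b (k n)" I \<beta>, OF _ lim])
  have "(\<Sum>i\<in>A. \<bar>b n i\<bar>) = 1" for n
  proof -
    have "(\<Sum>i\<in>A. \<bar>b n i\<bar>) = (1 / r n) * r n"
      using r0[of n] by (simp add: b_def abs_mult r_def flip: sum_divide_distrib)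
    then show ?thesis using r0[of n] by simp
  qed
  moreover have "(\<lambda>n. \<Sum>i\<in>A. \<bar>b (k n) i\<bar>) \<longlonglongrightarrow> (\<Sum>i\<in>A. \<bar>\<beta> i\<bar>)"
    by (intro tendsto_intros lim)
  ultimately have one: "(\<Sum>i\<in>A. \<bar>\<beta> i\<bar>) = 1"
    by (simp add: LIMSEQ_const_iff)
  have small: "L2_norm_sq M S (lincomb e A (b n)) \<le> c * ennreal (1 / (real n + 1))" for n
  proof -
    have "(1 / r n)\<^sup>2 \<le> 1 / (real n + 1)"
    proof -
      have "(1 / r n)\<^sup>2 \<le> (1 / (real n + 1))\<^sup>2"
        using r_gt[of n] by (intro power_mono frac_le) auto
      also have "\<dots> \<le> 1 / (real n + 1)"
        by (simp add: power2_eq_square divide_simps)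
      finally show ?thesis .
    qed
    moreover have "L2_norm_sq M S (lincomb e A (b n)) =
        ennreal ((1 / r n)\<^sup>2) * L2_norm_sq M S (lincomb e A (\<alpha> n))"
      unfolding b_def lincomb_scale
      by (rule L2_norm_sq_scale) (rule set_borel_measurable_lincomb[OF meas])
    ultimately show ?thesis
      using mult_mono[OF ennreal_leI \<alpha>(2)[of n]] by (simp add: mult.commute[of c])
  qed
  have "(\<lambda>n. c * ennreal (1 / (real n + 1))) \<longlonglongrightarrow> c * ennreal 0"
  proof (rule ennreal_tendsto_cmult[OF c])
    show "(\<lambda>n. ennreal (1 / (real n + 1))) \<longlonglongrightarrow> ennreal 0"
      using LIMSEQ_inverse_real_of_nat by (intro tendsto_ennrealI) (simp add: inverse_eq_divide add.commute)
  qed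
  then have "(\<lambda>n. c * ennreal (1 / (real n + 1))) \<longlonglongrightarrow> 0" by simp
  then have "(\<lambda>n. L2_norm_sq M S (lincomb e A (b n))) \<longlonglongrightarrow> 0"
    by (rule tendsto_sandwich[OF _ _ tendsto_const, rotated 2])
      (simp_all add: small always_eventually)
  then have "(\<lambda>n. L2_norm_sq M S (lincomb e A (b (k n)))) \<longlonglongrightarrow> 0"
    by (rule filterlim_compose[OF _ filterlim_subseq[OF k(1)]])
  then have lim0: "liminf (\<lambda>n. L2_norm_sq M S (lincomb e A (b (k n)))) = 0"
    by (rule lim_imp_Liminf[OF sequentially_bot])
  have "L2_norm_sq M S (lincomb e A \<beta>) \<le> liminf (\<lambda>n. L2_norm_sq M S (lincomb e A (b (k n))))"
    by (intro L2_norm_sq_le_liminf set_borel_measurable_lincomb meas lincomb_tendsto lim)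
  then have z: "L2_norm_sq M S (lincomb e A \<beta>) = 0" by (simp add: lim0)
  have [measurable]: "(\<lambda>x. indicator S x *\<^sub>R lincomb e A \<beta> x) \<in> borel_measurable M"
    using set_borel_measurable_lincomb[of A M S e, OF meas] by (simp add: set_borel_measurable_def)
  have "(\<lambda>x. ennreal ((norm (indicator S x *\<^sub>R lincomb e A \<beta> x))\<^sup>2)) \<in> borel_measurable M"
    by measurable
  then have "AE x in M. ennreal ((norm (indicator S x *\<^sub>R lincomb e A \<beta> x))\<^sup>2) = 0"
    using z unfolding L2_norm_sq_indicator by (simp only: nn_integral_0_iff_AE)
  then have "AE x in M. x \<in> S \<longrightarrow> lincomb e A \<beta> x = 0"
    by eventually_elim (auto simp: indicator_def)
  then have "\<beta> = (\<lambda>i. 0)" using ind \<beta>I by (auto simp: independent_AE_def)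
  with one show False by simp
qed

section \<open>Operators of Nemytskii type\<close>

text \<open>The common form of the two operators of the structural assumption: a continuous function of
  the values at \<open>x\<close> of finitely many bounded linear operators, and of \<open>H\<close>. The offsets \<open>k\<close> and \<open>l\<close>
  select the block of operators that map into \<open>C(S)\<close>.\<close>

definition nemytskii_operator ::
    "'a::euclidean_space set \<Rightarrow>
     ('a \<Rightarrow> real) set \<Rightarrow> (('a \<Rightarrow> real) \<Rightarrow> real) \<Rightarrow>
     ('a \<Rightarrow> real) set \<Rightarrow> (('a \<Rightarrow> real) \<Rightarrow> real) \<Rightarrow>
     (('a \<Rightarrow> real) \<Rightarrow> ('a \<Rightarrow> real) \<Rightarrow> real \<Rightarrow> 'a \<Rightarrow> 'p::euclidean_space) \<Rightarrow> bool" where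
  "nemytskii_operator S U nU V nV T \<longleftrightarrow>
     (\<exists>k n l p L J (G :: (nat \<Rightarrow> real) \<times> (nat \<Rightarrow> real) \<times> real \<Rightarrow> 'p).
        (\<forall>q\<in>{k+1..k+n}. bounded_linear_to_C U nU S (L q)) \<and>
        (\<forall>j\<in>{l+1..l+p}. bounded_linear_to_C V nV S (J j)) \<and>
        continuous_map
          (prod_topology (Euclidean_space n) (prod_topology (Euclidean_space p) euclidean)) euclidean G \<and>
        (\<forall>u\<in>U. \<forall>m\<in>V. \<forall>H. \<forall>x\<in>S.
           T u m H x = G (vec_from k n (\<lambda>q. L q u x), vec_from l p (\<lambda>j. J j m x), H)))"

text \<open>The boundary operator is given a dummy scalar argument, so that both operators can be treated
  at once.\<close>

lemma structural_assumption_nemytskii: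
  assumes "structural_assumption \<Omega> U nU V nV \<P> \<B>"
  shows "nemytskii_operator (interior \<Omega>) U nU V nV \<P>"
    and "nemytskii_operator (frontier \<Omega>) U nU V nV (\<lambda>u m H. \<B> u m)"
proof -
  obtain Q Qb D Db L J P B where
    le: "Qb \<le> Q" "Db \<le> D" and
    L1: "\<forall>q\<in>{1..Qb}. bounded_linear_to_C U nU (frontier \<Omega>) (L q)" and
    L2: "\<forall>q\<in>{Qb+1..Q}. bounded_linear_to_C U nU (interior \<Omega>) (L q)" and
    J1: "\<forall>j\<in>{1..Db}. bounded_linear_to_C V nV (frontier \<Omega>) (J j)" and
    J2: "\<forall>j\<in>{Db+1..D}. bounded_linear_to_C V nV (interior \<Omega>) (J j)" and
    P: "continuous_map
          (prod_topology (Euclidean_space (Q - Qb)) (prod_topology (Euclidean_space (D - Db)) euclidean))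
          euclidean P" and
    B: "continuous_map (prod_topology (Euclidean_space Qb) (Euclidean_space Db)) euclidean B" and
    eqP: "\<forall>u\<in>U. \<forall>m\<in>V. \<forall>H. \<forall>x\<in>interior \<Omega>.
       \<P> u m H x = P (vec_from Qb (Q - Qb) (\<lambda>q. L q u x), vec_from Db (D - Db) (\<lambda>j. J j m x), H)" and
    eqB: "\<forall>u\<in>U. \<forall>m\<in>V. \<forall>x\<in>frontier \<Omega>.
       \<B> u m x = B (vec_from 0 Qb (\<lambda>q. L q u x), vec_from 0 Db (\<lambda>j. J j m x))"
    using assms unfolding structural_assumption_def by (elim exE conjE) (rule that)
  show "nemytskii_operator (interior \<Omega>) U nU V nV \<P>"
    unfolding nemytskii_operator_def
    by (intro exI[of _ Qb] exI[of _ "Q - Qb"] exI[of _ Db] exI[of _ "D - Db"] exI[of _ L] exI[of _ J] exI[of _ P])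
      (use le L2 J2 P eqP in simp)
  have "continuous_map
      (prod_topology (Euclidean_space Qb) (prod_topology (Euclidean_space Db) euclidean))
      euclidean (B \<circ> (\<lambda>(a, b, H :: real). (a, b)))"
  proof (rule continuous_map_compose[OF _ B])
    show "continuous_map
      (prod_topology (Euclidean_space Qb) (prod_topology (Euclidean_space Db) euclidean))
      (prod_topology (Euclidean_space Qb) (Euclidean_space Db)) (\<lambda>(a, b, H :: real). (a, b))"
      unfolding case_prod_unfold continuous_map_pairwise o_def fst_conv snd_conv
      by (intro conjI continuous_map_fst continuous_map_fst_of[unfolded o_def] continuous_map_snd
          continuous_map_compose[OF continuous_map_snd continuous_map_fst, unfolded o_def])
  qed
  then show "nemytskii_operator (frontier \<Omega>) U nU V nV (\<lambda>u m H. \<B> u m)"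
    unfolding nemytskii_operator_def
    by (intro exI[of _ 0] exI[of _ Qb] exI[of _ Db] exI[of _ L] exI[of _ J]
        exI[of _ "B \<circ> (\<lambda>(a, b, H). (a, b))"])
      (use L1 J1 eqB in simp)
qed

lemma limitin_vec_from:
  assumes "\<And>q. q \<in> {k+1..k+n} \<Longrightarrow> ((\<lambda>j. a j q) \<longlongrightarrow> a' q) F"
  shows "limitin (Euclidean_space n) (\<lambda>j. vec_from k n (a j)) (vec_from k n a') F"
  unfolding Euclidean_space_def limitin_subtopology limitin_componentwise
  using assms by (auto simp: vec_from_def)

text \<open>Stated for a general filter, since it is used twice: with \<open>sequentially\<close> for the dependence
  on the coefficients, and with the filter \<open>at x within S\<close> for continuity in \<open>x\<close>, from which
  measurability follows.\<close>

lemma nemytskii_tendsto: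
  assumes G: "continuous_map
      (prod_topology (Euclidean_space n) (prod_topology (Euclidean_space p) euclidean)) euclidean
      (G :: _ \<Rightarrow> 'p::euclidean_space)"
    and a: "\<And>q. q \<in> {k+1..k+n} \<Longrightarrow> ((\<lambda>j. a j q) \<longlongrightarrow> a' q) F"
    and b: "\<And>q. q \<in> {l+1..l+p} \<Longrightarrow> ((\<lambda>j. b j q) \<longlongrightarrow> b' q) F"
    and H: "(H \<longlongrightarrow> H') F"
  shows "((\<lambda>j. G (vec_from k n (a j), vec_from l p (b j), H j)) \<longlongrightarrow>
    G (vec_from k n a', vec_from l p b', H' :: real)) F"
proof -
  have "limitin (prod_topology (Euclidean_space n) (prod_topology (Euclidean_space p) euclidean))
      (\<lambda>j. (vec_from k n (a j), vec_from l p (b j), H j)) (vec_from k n a', vec_from l p b', H') F"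
    using limitin_vec_from[of k n a a' F, OF a] limitin_vec_from[of l p b b' F, OF b] H
    by (simp add: limitin_pairwise o_def)
  from continuous_map_limit[OF G this] show ?thesis by (simp add: o_def)
qed

lemma banach_function_spaceD:
  assumes "banach_function_space \<Omega> U nrm"
  shows "(\<lambda>x. 0) \<in> U"
    and "f \<in> U \<Longrightarrow> g \<in> U \<Longrightarrow> (\<lambda>x. f x + g x) \<in> U"
    and "f \<in> U \<Longrightarrow> (\<lambda>x. c * f x) \<in> U"
    and "f \<in> U \<Longrightarrow> AE x in lebesgue. x \<in> \<Omega> \<longrightarrow> f x = 0 \<Longrightarrow> nrm f = 0"
  using assms by (simp_all add: banach_function_space_def)

lemma bounded_linear_to_CD:
  assumes "bounded_linear_to_C U nrm S L"
  shows "f \<in> U \<Longrightarrow> continuous_on S (L f)"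
    and "f \<in> U \<Longrightarrow> g \<in> U \<Longrightarrow> x \<in> S \<Longrightarrow> L (\<lambda>y. f y + g y) x = L f x + L g x"
    and "f \<in> U \<Longrightarrow> x \<in> S \<Longrightarrow> L (\<lambda>y. c * f y) x = c * L f x"
    and "compact K \<Longrightarrow> K \<subseteq> S \<Longrightarrow> \<exists>C. \<forall>f\<in>U. \<forall>x\<in>K. \<bar>L f x\<bar> \<le> C * nrm f"
  using assms by (simp_all add: bounded_linear_to_C_def)

lemma banach_function_space_lincomb:
  assumes U: "banach_function_space \<Omega> U nU" and "finite A" and e: "\<And>i. i \<in> A \<Longrightarrow> e i \<in> U"
  shows "lincomb e A \<alpha> \<in> U"
  using assms(2,3)
proof (induction A)
  case empty
  then show ?case using banach_function_spaceD(1)[OF U] by (simp add: lincomb_def[abs_def])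
next
  case (insert j A)
  have "(\<lambda>x. (\<alpha> j * e j x) + lincomb e A \<alpha> x) \<in> U"
    using insert by (intro banach_function_spaceD[OF U]) auto
  then show ?case using insert.hyps by (simp add: lincomb_def[abs_def])
qed

lemma bounded_linear_to_C_lincomb:
  assumes U: "banach_function_space \<Omega> U nU" and L: "bounded_linear_to_C U nU S L"
    and "finite A" and e: "\<And>i. i \<in> A \<Longrightarrow> e i \<in> U" and x: "x \<in> S"
  shows "L (lincomb e A \<alpha>) x = lincomb (\<lambda>i. L (e i)) A \<alpha> x"
  using assms(3,4)
proof (induction A)
  case empty
  have "(\<lambda>x. 0) \<in> U" by (rule banach_function_spaceD(1)[OF U])
  then have "L (\<lambda>y. 0 * (\<lambda>x. 0) y) x = 0 * L (\<lambda>x. 0) x"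
    using x by (rule bounded_linear_to_CD(3)[OF L])
  then show ?case by (simp add: lincomb_def[abs_def])
next
  case (insert j A)
  have 1: "lincomb e A \<alpha> \<in> U"
    using insert by (intro banach_function_space_lincomb[OF U]) auto
  have ej: "e j \<in> U" using insert by simp
  then have 2: "(\<lambda>y. \<alpha> j * e j y) \<in> U"
    by (rule banach_function_spaceD(3)[OF U])
  have "lincomb e (insert j A) \<alpha> = (\<lambda>y. \<alpha> j * e j y + lincomb e A \<alpha> y)"
    using insert.hyps by (simp add: lincomb_def[abs_def])
  then have "L (lincomb e (insert j A) \<alpha>) x = L (\<lambda>y. \<alpha> j * e j y + lincomb e A \<alpha> y) x"
    by simp
  also have "\<dots> = L (\<lambda>y. \<alpha> j * e j y) x + L (lincomb e A \<alpha>) x"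
    using 2 1 x by (rule bounded_linear_to_CD(2)[OF L])
  also have "L (\<lambda>y. \<alpha> j * e j y) x = \<alpha> j * L (e j) x"
    using ej x by (rule bounded_linear_to_CD(3)[OF L])
  finally show ?case using insert by (simp add: lincomb_def)
qed

text \<open>The point \<open>x\<close> may lie outside \<open>\<Omega>\<close> or in a null set. Boundedness on the compact set \<open>{x}\<close>
  gives \<open>\<bar>L (f - g) x\<bar> \<le> C * nU (f - g) = 0\<close>.\<close>

lemma bounded_linear_to_C_cong_AE:
  assumes U: "banach_function_space \<Omega> U nU" and L: "bounded_linear_to_C U nU S L"
    and f: "f \<in> U" and g: "g \<in> U" and eq: "AE x in lebesgue. x \<in> \<Omega> \<longrightarrow> f x = g x" and x: "x \<in> S"
  shows "L f x = L g x"
proof -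
  have mg: "(\<lambda>y. (-1) * g y) \<in> U" using g by (rule banach_function_spaceD(3)[OF U])
  have "(\<lambda>y. f y + (\<lambda>y. (-1) * g y) y) \<in> U"
    using f mg by (rule banach_function_spaceD(2)[OF U])
  then have d: "(\<lambda>y. f y - g y) \<in> U" by simp
  have "AE x in lebesgue. x \<in> \<Omega> \<longrightarrow> f x - g x = 0"
    using eq by eventually_elim simp
  then have n0: "nU (\<lambda>y. f y - g y) = 0"
    using d by (intro banach_function_spaceD(4)[OF U])
  have "compact {x}" "{x} \<subseteq> S" using x by auto
  from bounded_linear_to_CD(4)[OF L this]
  obtain C where C: "\<forall>h\<in>U. \<forall>y\<in>{x}. \<bar>L h y\<bar> \<le> C * nU h" ..
  have "\<bar>L (\<lambda>y. f y - g y) x\<bar> \<le> C * nU (\<lambda>y. f y - g y)"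
    using C d by simp
  then have z: "L (\<lambda>y. f y - g y) x = 0" by (simp add: n0)
  have "L (\<lambda>y. g y + (\<lambda>y. f y - g y) y) x = L g x + L (\<lambda>y. f y - g y) x"
    using g d x by (rule bounded_linear_to_CD(2)[OF L])
  then show ?thesis by (simp add: z)
qed

lemma nemytskii_operator_cong_AE:
  assumes T: "nemytskii_operator S U nU V nV T"
    and U: "banach_function_space \<Omega> U nU" and V: "banach_function_space \<Omega> V nV"
    and "u \<in> U" "u' \<in> U" "AE x in lebesgue. x \<in> \<Omega> \<longrightarrow> u x = u' x"
    and "m \<in> V" "m' \<in> V" "AE x in lebesgue. x \<in> \<Omega> \<longrightarrow> m x = m' x"
    and x: "x \<in> S"
  shows "T u m H x = T u' m' H x"
proof -
  obtain k n l p L J G where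
    L: "\<forall>q\<in>{k+1..k+n}. bounded_linear_to_C U nU S (L q)" and
    J: "\<forall>j\<in>{l+1..l+p}. bounded_linear_to_C V nV S (J j)" and
    T: "\<forall>u\<in>U. \<forall>m\<in>V. \<forall>H. \<forall>x\<in>S.
       T u m H x = G (vec_from k n (\<lambda>q. L q u x), vec_from l p (\<lambda>j. J j m x), H)"
    using T unfolding nemytskii_operator_def by (elim exE conjE) (rule that)
  have "L q u x = L q u' x" if "q \<in> {k+1..k+n}" for q
    using L that x assms by (intro bounded_linear_to_C_cong_AE[OF U]) auto
  then have 1: "vec_from k n (\<lambda>q. L q u x) = vec_from k n (\<lambda>q. L q u' x)"
    by (auto simp: vec_from_def)
  have "J q m x = J q m' x" if "q \<in> {l+1..l+p}" for q
    using J that x assms by (intro bounded_linear_to_C_cong_AE[OF V]) auto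
  then have 2: "vec_from l p (\<lambda>q. J q m x) = vec_from l p (\<lambda>q. J q m' x)"
    by (auto simp: vec_from_def)
  show ?thesis using T assms x 1 2 by simp
qed

lemma nemytskii_operator_continuous_on:
  assumes T: "nemytskii_operator S U nU V nV T" and u: "u \<in> U" and m: "m \<in> V"
  shows "continuous_on S (T u m H)"
proof -
  obtain k n l p L J G where
    L: "\<forall>q\<in>{k+1..k+n}. bounded_linear_to_C U nU S (L q)" and
    J: "\<forall>j\<in>{l+1..l+p}. bounded_linear_to_C V nV S (J j)" and
    G: "continuous_map
      (prod_topology (Euclidean_space n) (prod_topology (Euclidean_space p) euclidean)) euclidean G" and
    T: "\<forall>u\<in>U. \<forall>m\<in>V. \<forall>H. \<forall>x\<in>S.
       T u m H x = G (vec_from k n (\<lambda>q. L q u x), vec_from l p (\<lambda>j. J j m x), H)"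
    using T unfolding nemytskii_operator_def by (elim exE conjE) (rule that)
  have "continuous_on S (\<lambda>x. G (vec_from k n (\<lambda>q. L q u x), vec_from l p (\<lambda>j. J j m x), H))"
    unfolding continuous_on_def
  proof (intro ballI nemytskii_tendsto[OF G])
    fix x q assume x: "x \<in> S" and "q \<in> {k+1..k+n}"
    then have "continuous_on S (L q u)" using L u by (intro bounded_linear_to_CD(1)) auto
    then show "(L q u \<longlongrightarrow> L q u x) (at x within S)" using x by (simp add: continuous_on_def)
  next
    fix x q assume x: "x \<in> S" and "q \<in> {l+1..l+p}"
    then have "continuous_on S (J q m)" using J m by (intro bounded_linear_to_CD(1)) auto
    then show "(J q m \<longlongrightarrow> J q m x) (at x within S)" using x by (simp add: continuous_on_def)
  qed simp
  then show ?thesis by (rule continuous_on_eq) (use T u m in simp)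
qed

lemma nemytskii_operator_lincomb_tendsto:
  assumes T: "nemytskii_operator S U nU V nV T"
    and U: "banach_function_space \<Omega> U nU" and V: "banach_function_space \<Omega> V nV"
    and A: "finite A" and eU: "\<And>i. i \<in> A \<Longrightarrow> e i \<in> U" and eV: "\<And>i. i \<in> A \<Longrightarrow> f i \<in> V"
    and \<alpha>: "\<And>i. ((\<lambda>n. \<alpha> n i) \<longlongrightarrow> \<alpha>' i) F" and \<beta>: "\<And>i. ((\<lambda>n. \<beta> n i) \<longlongrightarrow> \<beta>' i) F"
    and H: "(H \<longlongrightarrow> H') F" and x: "x \<in> S"
  shows "((\<lambda>n. T (lincomb e A (\<alpha> n)) (lincomb f A (\<beta> n)) (H n) x) \<longlongrightarrow>
           T (lincomb e A \<alpha>') (lincomb f A \<beta>') H' x) F"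
proof -
  obtain k n l p L J G where
    L: "\<forall>q\<in>{k+1..k+n}. bounded_linear_to_C U nU S (L q)" and
    J: "\<forall>j\<in>{l+1..l+p}. bounded_linear_to_C V nV S (J j)" and
    G: "continuous_map
      (prod_topology (Euclidean_space n) (prod_topology (Euclidean_space p) euclidean)) euclidean G" and
    T: "\<forall>u\<in>U. \<forall>m\<in>V. \<forall>H. \<forall>x\<in>S.
       T u m H x = G (vec_from k n (\<lambda>q. L q u x), vec_from l p (\<lambda>j. J j m x), H)"
    using T unfolding nemytskii_operator_def by (elim exE conjE) (rule that)
  have Tx: "T (lincomb e A a) (lincomb f A b) h x =
      G (vec_from k n (\<lambda>q. L q (lincomb e A a) x), vec_from l p (\<lambda>j. J j (lincomb f A b) x), h)" for a b h
    using T x banach_function_space_lincomb[of \<Omega> U nU A e, OF U A eU]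
      banach_function_space_lincomb[of \<Omega> V nV A f, OF V A eV] by simp
  show ?thesis
    unfolding Tx
  proof (rule nemytskii_tendsto[OF G _ _ H])
    fix q assume q: "q \<in> {k+1..k+n}"
    then have "L q (lincomb e A a) x = lincomb (\<lambda>i. L q (e i)) A a x" for a
      using L eU x A by (intro bounded_linear_to_C_lincomb[OF U]) auto
    then show "((\<lambda>n. L q (lincomb e A (\<alpha> n)) x) \<longlongrightarrow> L q (lincomb e A \<alpha>') x) F"
      by (simp add: lincomb_tendsto \<alpha>)
  next
    fix q assume q: "q \<in> {l+1..l+p}"
    then have "J q (lincomb f A a) x = lincomb (\<lambda>i. J q (f i)) A a x" for a
      using J eV x A by (intro bounded_linear_to_C_lincomb[OF V]) auto
    then show "((\<lambda>n. J q (lincomb f A (\<beta> n)) x) \<longlongrightarrow> J q (lincomb f A \<beta>') x) F"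
      by (simp add: lincomb_tendsto \<beta>)
  qed
qed

section \<open>The objective on feature spaces\<close>

lemma objective_cong_AE:
  fixes \<P> :: "('a::euclidean_space \<Rightarrow> real) \<Rightarrow> ('a \<Rightarrow> real) \<Rightarrow> real \<Rightarrow> 'a \<Rightarrow> 'p::euclidean_space"
    and \<B> :: "('a \<Rightarrow> real) \<Rightarrow> ('a \<Rightarrow> real) \<Rightarrow> 'a \<Rightarrow> 'b::euclidean_space"
  assumes st: "structural_assumption \<Omega> U nU V nV \<P> \<B>"
    and U: "banach_function_space \<Omega> U nU" and V: "banach_function_space \<Omega> V nV"
    and u: "u \<in> U" "u' \<in> U" "AE x in lebesgue. x \<in> \<Omega> \<longrightarrow> u x = u' x"
    and m: "m \<in> V" "m' \<in> V" "AE x in lebesgue. x \<in> \<Omega> \<longrightarrow> m x = m' x"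
    and int: "set_integrable lebesgue \<Omega> u" "set_integrable lebesgue \<Omega> u'"
      "set_integrable lebesgue \<Omega> m" "set_integrable lebesgue \<Omega> m'"
  shows "objective \<Omega> \<P> \<B> \<gamma> u m H = objective \<Omega> \<P> \<B> \<gamma> u' m' H"
proof -
  have "\<P> u m H x = \<P> u' m' H x" if "x \<in> interior \<Omega>" for x
    using nemytskii_operator_cong_AE[OF structural_assumption_nemytskii(1)[OF st] U V u m that] .
  then have P: "L2_norm_sq lebesgue (interior \<Omega>) (\<P> u m H) = L2_norm_sq lebesgue (interior \<Omega>) (\<P> u' m' H)"
    by (intro L2_norm_sq_cong_AE) simp
  have "\<B> u m x = \<B> u' m' x" if "x \<in> frontier \<Omega>" for x
    using nemytskii_operator_cong_AE[OF structural_assumption_nemytskii(2)[OF st] U V u m that] .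
  then have B: "L2_norm_sq (hausdorff_measure k) (frontier \<Omega>) (\<B> u m) =
      L2_norm_sq (hausdorff_measure k) (frontier \<Omega>) (\<B> u' m')" for k
    by (intro L2_norm_sq_cong_AE) simp
  have int_eq: "(LINT x:\<Omega>|lebesgue. f x) = (LINT x:\<Omega>|lebesgue. g x)"
    if "set_integrable lebesgue \<Omega> f" "set_integrable lebesgue \<Omega> g"
      "AE x in lebesgue. x \<in> \<Omega> \<longrightarrow> f x = g x" for f g :: "'a \<Rightarrow> real"
    unfolding set_lebesgue_integral_def
  proof (rule integral_cong_AE)
    show "AE x in lebesgue. indicator \<Omega> x *\<^sub>R f x = indicator \<Omega> x *\<^sub>R g x"
      using that(3) by eventually_elim (auto simp: indicator_def)
  qed (use that(1,2) in \<open>auto simp: set_integrable_def\<close>)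
  show ?thesis
    unfolding objective_def P B
    by (simp only: int_eq[OF int(1,2) u(3)] int_eq[OF int(3,4) m(3)]
        L2_norm_sq_cong_AE[OF u(3)] L2_norm_sq_cong_AE[OF m(3)])
qed

lemma set_lebesgue_integral_lincomb:
  assumes "\<And>i. i \<in> A \<Longrightarrow> set_integrable M S (e i)"
  shows "(LINT x:S|M. lincomb e A \<alpha> x) = (\<Sum>i\<in>A. \<alpha> i * (LINT x:S|M. e i x))"
proof -
  have "(LINT x:S|M. lincomb e A \<alpha> x) = (LINT x|M. (\<Sum>i\<in>A. \<alpha> i * (indicator S x *\<^sub>R e i x)))"
    unfolding set_lebesgue_integral_def lincomb_def
    by (intro Bochner_Integration.integral_cong) (simp_all add: sum_distrib_left algebra_simps)
  also have "\<dots> = (\<Sum>i\<in>A. LINT x|M. \<alpha> i * (indicator S x *\<^sub>R e i x))"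
    using assms by (intro Bochner_Integration.integral_sum integrable_mult_right) (simp add: set_integrable_def)
  finally show ?thesis by (simp add: set_lebesgue_integral_def)
qed

lemma set_lebesgue_integral_lincomb_tendsto:
  assumes "\<And>i. i \<in> A \<Longrightarrow> set_integrable M S (e i)" "\<And>i. ((\<lambda>n. \<alpha> n i) \<longlongrightarrow> \<beta> i) F"
  shows "((\<lambda>n. LINT x:S|M. lincomb e A (\<alpha> n) x) \<longlongrightarrow> (LINT x:S|M. lincomb e A \<beta> x)) F"
proof -
  have "((\<lambda>n. \<Sum>i\<in>A. \<alpha> n i * (LINT x:S|M. e i x)) \<longlongrightarrow> (\<Sum>i\<in>A. \<beta> i * (LINT x:S|M. e i x))) F"
    by (intro tendsto_intros assms)
  moreover have "(LINT x:S|M. lincomb e A a x) = (\<Sum>i\<in>A. a i * (LINT x:S|M. e i x))" for a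
    by (rule set_lebesgue_integral_lincomb) (rule assms)
  ultimately show ?thesis by simp
qed

text \<open>Each of the seven terms is lower semicontinuous, the norms by Fatou's lemma and the others by
  continuity, and the limit inferior is superadditive.\<close>

lemma objective_lincomb_lsc:
  fixes \<P> :: "('a::euclidean_space \<Rightarrow> real) \<Rightarrow> ('a \<Rightarrow> real) \<Rightarrow> real \<Rightarrow> 'a \<Rightarrow> 'p::euclidean_space"
    and \<B> :: "('a \<Rightarrow> real) \<Rightarrow> ('a \<Rightarrow> real) \<Rightarrow> 'a \<Rightarrow> 'b::euclidean_space"
  assumes st: "structural_assumption \<Omega> U nU V nV \<P> \<B>"
    and U: "banach_function_space \<Omega> U nU" and V: "banach_function_space \<Omega> V nV"
    and A: "finite A" and eU: "\<And>i. i \<in> A \<Longrightarrow> e i \<in> U" and fV: "\<And>i. i \<in> A \<Longrightarrow> f i \<in> V"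
    and ei: "\<And>i. i \<in> A \<Longrightarrow> set_integrable lebesgue \<Omega> (e i)"
    and fi: "\<And>i. i \<in> A \<Longrightarrow> set_integrable lebesgue \<Omega> (f i)"
    and \<alpha>: "\<And>i. (\<lambda>n. \<alpha> n i) \<longlonglongrightarrow> \<alpha>' i" and \<beta>: "\<And>i. (\<lambda>n. \<beta> n i) \<longlonglongrightarrow> \<beta>' i"
    and H: "H \<longlonglongrightarrow> H'"
  shows "objective \<Omega> \<P> \<B> \<gamma> (lincomb e A \<alpha>') (lincomb f A \<beta>') H' \<le>
    liminf (\<lambda>n. objective \<Omega> \<P> \<B> \<gamma> (lincomb e A (\<alpha> n)) (lincomb f A (\<beta> n)) (H n))"
proof -
  have meas: "set_borel_measurable lebesgue \<Omega> g" if "set_integrable lebesgue \<Omega> g" for g :: "'a \<Rightarrow> real"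
    using that by (auto simp: set_integrable_def set_borel_measurable_def)
  have mem: "lincomb e A a \<in> U" "lincomb f A a \<in> V" for a
    using A eU fV by (auto intro: banach_function_space_lincomb[OF U] banach_function_space_lincomb[OF V])
  note nP = structural_assumption_nemytskii(1)[OF st] and nB = structural_assumption_nemytskii(2)[OF st]
  have u: "L2_norm_sq lebesgue \<Omega> (lincomb e A \<alpha>') \<le> liminf (\<lambda>n. L2_norm_sq lebesgue \<Omega> (lincomb e A (\<alpha> n)))"
    by (intro L2_norm_sq_le_liminf set_borel_measurable_lincomb meas ei lincomb_tendsto \<alpha>)
  have m: "L2_norm_sq lebesgue \<Omega> (lincomb f A \<beta>') \<le> liminf (\<lambda>n. L2_norm_sq lebesgue \<Omega> (lincomb f A (\<beta> n)))"
    by (intro L2_norm_sq_le_liminf set_borel_measurable_lincomb meas fi lincomb_tendsto \<beta>)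
  have h: "ennreal (\<bar>H'\<bar>\<^sup>2) \<le> liminf (\<lambda>n. ennreal (\<bar>H n\<bar>\<^sup>2))"
    by (intro le_liminf_tendsto tendsto_ennrealI tendsto_intros H)
  have P: "ennreal \<gamma> * L2_norm_sq lebesgue (interior \<Omega>) (\<P> (lincomb e A \<alpha>') (lincomb f A \<beta>') H') \<le>
    liminf (\<lambda>n. ennreal \<gamma> * L2_norm_sq lebesgue (interior \<Omega>) (\<P> (lincomb e A (\<alpha> n)) (lincomb f A (\<beta> n)) (H n)))"
  proof (rule order_trans[OF mult_left_mono liminf_cmult_ge])
    show "L2_norm_sq lebesgue (interior \<Omega>) (\<P> (lincomb e A \<alpha>') (lincomb f A \<beta>') H') \<le>
      liminf (\<lambda>n. L2_norm_sq lebesgue (interior \<Omega>) (\<P> (lincomb e A (\<alpha> n)) (lincomb f A (\<beta> n)) (H n)))"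
    proof (rule L2_norm_sq_le_liminf)
      fix n
      have "(\<lambda>x. indicator (interior \<Omega>) x *\<^sub>R \<P> (lincomb e A (\<alpha> n)) (lincomb f A (\<beta> n)) (H n) x) \<in> borel_measurable borel"
        by (intro borel_measurable_continuous_on_indicator nemytskii_operator_continuous_on[OF nP] mem) simp
      then show "set_borel_measurable lebesgue (interior \<Omega>) (\<P> (lincomb e A (\<alpha> n)) (lincomb f A (\<beta> n)) (H n))"
        unfolding set_borel_measurable_def by (intro measurable_completion) simp
    qed (rule nemytskii_operator_lincomb_tendsto[OF nP U V A eU fV \<alpha> \<beta> H])
  qed simp
  have B: "ennreal \<gamma> * L2_norm_sq (hausdorff_measure k) (frontier \<Omega>) (\<B> (lincomb e A \<alpha>') (lincomb f A \<beta>')) \<le>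
    liminf (\<lambda>n. ennreal \<gamma> * L2_norm_sq (hausdorff_measure k) (frontier \<Omega>) (\<B> (lincomb e A (\<alpha> n)) (lincomb f A (\<beta> n))))" for k
  proof (rule order_trans[OF mult_left_mono liminf_cmult_ge])
    show "L2_norm_sq (hausdorff_measure k) (frontier \<Omega>) (\<B> (lincomb e A \<alpha>') (lincomb f A \<beta>')) \<le>
      liminf (\<lambda>n. L2_norm_sq (hausdorff_measure k) (frontier \<Omega>) (\<B> (lincomb e A (\<alpha> n)) (lincomb f A (\<beta> n))))"
    proof (rule L2_norm_sq_le_liminf)
      fix n
      have "(\<lambda>x. indicator (frontier \<Omega>) x *\<^sub>R \<B> (lincomb e A (\<alpha> n)) (lincomb f A (\<beta> n)) x) \<in> borel_measurable borel"
        by (intro borel_measurable_continuous_on_indicator nemytskii_operator_continuous_on[OF nB] mem) simp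
      moreover have "borel_measurable (hausdorff_measure k) = (borel_measurable borel :: ('a \<Rightarrow> 'b) set)"
        by (rule measurable_cong_sets) simp_all
      ultimately show "set_borel_measurable (hausdorff_measure k) (frontier \<Omega>) (\<B> (lincomb e A (\<alpha> n)) (lincomb f A (\<beta> n)))"
        unfolding set_borel_measurable_def by simp
    qed (rule nemytskii_operator_lincomb_tendsto[OF nB U V A eU fV \<alpha> \<beta> H])
  qed simp
  have mi: "ennreal (\<gamma> * \<bar>(LINT x:\<Omega>|lebesgue. lincomb f A \<beta>' x) - 1\<bar>\<^sup>2) \<le>
      liminf (\<lambda>n. ennreal (\<gamma> * \<bar>(LINT x:\<Omega>|lebesgue. lincomb f A (\<beta> n) x) - 1\<bar>\<^sup>2))"
    by (intro le_liminf_tendsto tendsto_ennrealI tendsto_mult tendsto_const tendsto_power tendsto_rabs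
        tendsto_diff set_lebesgue_integral_lincomb_tendsto[OF fi \<beta>])
  have ui: "ennreal (\<gamma> * \<bar>LINT x:\<Omega>|lebesgue. lincomb e A \<alpha>' x\<bar>\<^sup>2) \<le>
      liminf (\<lambda>n. ennreal (\<gamma> * \<bar>LINT x:\<Omega>|lebesgue. lincomb e A (\<alpha> n) x\<bar>\<^sup>2))"
    by (intro le_liminf_tendsto tendsto_ennrealI tendsto_mult tendsto_const tendsto_power tendsto_rabs
        tendsto_diff set_lebesgue_integral_lincomb_tendsto[OF ei \<alpha>])
  note add = order_trans[OF add_mono liminf_add_ge]
  show ?thesis
    unfolding objective_def
    by (rule add[OF add[OF add[OF add[OF add[OF add[OF u m] h] P] B] mi] ui])
qed

lemma objective_ge:
  "L2_norm_sq lebesgue \<Omega> u \<le> objective \<Omega> \<P> \<B> \<gamma> u m H"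
  "L2_norm_sq lebesgue \<Omega> m \<le> objective \<Omega> \<P> \<B> \<gamma> u m H"
  "ennreal (\<bar>H\<bar>\<^sup>2) \<le> objective \<Omega> \<P> \<B> \<gamma> u m H"
  unfolding objective_def by (simp_all add: add_increasing add_increasing2)

lemma feature_space_eq_range: "feature_space \<zeta> N \<omega> = range (lincomb (\<lambda>i x. \<zeta> x (\<omega> i)) {1..N})"
  by (auto simp: feature_space_def lincomb_def[abs_def])

lemma feature_mem: "i \<in> {1..N} \<Longrightarrow> (\<lambda>x. \<zeta> x (\<omega> i)) \<in> feature_space \<zeta> N \<omega>"
  unfolding feature_space_def
  by (intro CollectI exI[of _ "\<lambda>j. if j = i then 1 else 0"])
    (simp add: if_distrib[of "\<lambda>c. c * _"] sum.delta cong: if_cong)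

theorem theorem3p10:
  fixes \<Omega> :: "(real ^ 'd) set"
    and W :: "'w set"
    and \<zeta> :: "real ^ 'd \<Rightarrow> 'w \<Rightarrow> real"
    and N :: nat
    and \<omega> \<tau> :: "nat \<Rightarrow> 'w"
    and U V :: "(real ^ 'd \<Rightarrow> real) set"
    and nU nV :: "(real ^ 'd \<Rightarrow> real) \<Rightarrow> real"
    and \<P> :: "(real ^ 'd \<Rightarrow> real) \<Rightarrow> (real ^ 'd \<Rightarrow> real) \<Rightarrow> real \<Rightarrow> real ^ 'd \<Rightarrow> 'p::euclidean_space"
    and \<B> :: "(real ^ 'd \<Rightarrow> real) \<Rightarrow> (real ^ 'd \<Rightarrow> real) \<Rightarrow> real ^ 'd \<Rightarrow> 'b::euclidean_space"
    and \<gamma> :: real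
  assumes "\<Omega> \<in> sets lebesgue"
    and "\<And>w x. w \<in> W \<Longrightarrow> x \<in> \<Omega> \<Longrightarrow> \<bar>\<zeta> x w\<bar> \<le> 1"
    and "\<And>w. w \<in> W \<Longrightarrow> set_integrable lebesgue \<Omega> (\<lambda>x. (\<zeta> x w)\<^sup>2)"
    and "\<And>i. i \<in> {1..N} \<Longrightarrow> \<omega> i \<in> W"
    and "\<And>i. i \<in> {1..N} \<Longrightarrow> \<tau> i \<in> W"
    and "banach_function_space \<Omega> U nU"
    and "banach_function_space \<Omega> V nV"
    and "feature_space \<zeta> N \<omega> \<subseteq> U"
    and "feature_space \<zeta> N \<tau> \<subseteq> V"
    and "\<And>u. u \<in> feature_space \<zeta> N \<omega> \<Longrightarrow> set_integrable lebesgue \<Omega> u"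
    and "\<And>m. m \<in> feature_space \<zeta> N \<tau> \<Longrightarrow> set_integrable lebesgue \<Omega> m"
    and "structural_assumption \<Omega> U nU V nV \<P> \<B>"
    and "\<gamma> \<ge> 0"
  shows "\<exists>u m H. is_arg_min (\<lambda>(u, m, H). objective \<Omega> \<P> \<B> \<gamma> u m H)
           (\<lambda>(u, m, H). u \<in> feature_space \<zeta> N \<omega> \<and> m \<in> feature_space \<zeta> N \<tau>) (u, m, H)"
proof -
  define A where "A = {1..N}"
  define e where "e = (\<lambda>i x. \<zeta> x (\<omega> i))"
  define f where "f = (\<lambda>i x. \<zeta> x (\<tau> i))"
  note U = assms(6) and V = assms(7) and st = assms(12)
  have A: "finite A" by (simp add: A_def)
  have FU: "feature_space \<zeta> N \<omega> = range (lincomb e A)" and FV: "feature_space \<zeta> N \<tau> = range (lincomb f A)"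
    by (simp_all add: feature_space_eq_range A_def e_def f_def)
  have "e i \<in> feature_space \<zeta> N \<omega>" "f i \<in> feature_space \<zeta> N \<tau>" if "i \<in> A" for i
    using that feature_mem[of i N] by (simp_all add: A_def e_def f_def)
  then have eU: "e i \<in> U" and ei: "set_integrable lebesgue \<Omega> (e i)"
    and fV: "f i \<in> V" and fi: "set_integrable lebesgue \<Omega> (f i)" if "i \<in> A" for i
    using that assms(8-11) by (meson subsetD)+
  have meas: "set_borel_measurable lebesgue \<Omega> g" if "set_integrable lebesgue \<Omega> g" for g :: "real^'d \<Rightarrow> real"
    using that by (auto simp: set_integrable_def set_borel_measurable_def)
  obtain I where I: "I \<subseteq> A" "independent_AE lebesgue \<Omega> e A I" "spanning_AE lebesgue \<Omega> e A I"
    using exists_independent_spanning_AE[OF A] .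
  obtain J where J: "J \<subseteq> A" "independent_AE lebesgue \<Omega> f A J" "spanning_AE lebesgue \<Omega> f A J"
    using exists_independent_spanning_AE[OF A] .
  define F where "F = (\<lambda>(\<alpha>, \<beta>, H). objective \<Omega> \<P> \<B> \<gamma> (lincomb e A \<alpha>) (lincomb f A \<beta>) H)"
  define X where "X = supported_on I \<times> supported_on J \<times> (UNIV :: real set)"
  \<comment> \<open>The restriction to independent indices is what makes \<open>F\<close> coercive on \<open>X\<close>.\<close>
  have "\<exists>x\<in>X. \<forall>y\<in>X. F x \<le> F y"
  proof (rule coercive_lsc_attains_min)
    have "((\<lambda>_. 0), (\<lambda>_. 0), 0) \<in> X" by (simp add: X_def supported_on_def)
    then show "X \<noteq> {}" by blast
  next
    fix c :: ennreal assume c: "c < top"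
    obtain C where C: "\<And>\<alpha> i. \<alpha> \<in> supported_on I \<Longrightarrow> L2_norm_sq lebesgue \<Omega> (lincomb e A \<alpha>) \<le> c \<Longrightarrow> \<bar>\<alpha> i\<bar> \<le> C"
      using L2_sublevel_coefficients_bounded[OF A I(1) meas[OF ei] I(2) c] by blast
    obtain D where D: "\<And>\<alpha> i. \<alpha> \<in> supported_on J \<Longrightarrow> L2_norm_sq lebesgue \<Omega> (lincomb f A \<alpha>) \<le> c \<Longrightarrow> \<bar>\<alpha> i\<bar> \<le> D"
      using L2_sublevel_coefficients_bounded[OF A J(1) meas[OF fi] J(2) c] by blast
    \<comment> \<open>The sublevel set satisfies \<open>\<bar>H\<bar>\<^sup>2 \<le> c\<close>.\<close>
    define h where "h = sqrt (enn2real c)"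
    define K where "K = {\<alpha> :: nat \<Rightarrow> real. \<forall>i. \<bar>\<alpha> i\<bar> \<le> C} \<times> {\<beta> :: nat \<Rightarrow> real. \<forall>i. \<bar>\<beta> i\<bar> \<le> D} \<times> {-h..h}"
    have "compact K" unfolding K_def by (intro compact_Times compact_box_fun compact_Icc)
    moreover have "{x \<in> X. F x \<le> c} \<subseteq> K"
    proof clarify
      fix \<alpha> \<beta> H assume x: "(\<alpha>, \<beta>, H) \<in> X" "F (\<alpha>, \<beta>, H) \<le> c"
      then have le: "objective \<Omega> \<P> \<B> \<gamma> (lincomb e A \<alpha>) (lincomb f A \<beta>) H \<le> c" by (simp add: F_def)
      have "ennreal (\<bar>H\<bar>\<^sup>2) \<le> ennreal (enn2real c)"
        using order_trans[OF objective_ge(3) le] c by simp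
      then have "H\<^sup>2 \<le> enn2real c" by simp
      then have "\<bar>H\<bar> \<le> h" unfolding h_def by (simp add: real_le_rsqrt)
      moreover have "\<bar>\<alpha> i\<bar> \<le> C" for i
        using x(1) order_trans[OF objective_ge(1) le] by (intro C) (simp_all add: X_def)
      moreover have "\<bar>\<beta> i\<bar> \<le> D" for i
        using x(1) order_trans[OF objective_ge(2) le] by (intro D) (simp_all add: X_def)
      ultimately show "(\<alpha>, \<beta>, H) \<in> K" by (auto simp: K_def)
    qed
    ultimately show "\<exists>K. compact K \<and> {x \<in> X. F x \<le> c} \<subseteq> K" by blast
  next
    fix s :: "nat \<Rightarrow> (nat \<Rightarrow> real) \<times> (nat \<Rightarrow> real) \<times> real" and l
    assume s: "\<And>n. s n \<in> X" and lim: "s \<longlonglongrightarrow> l"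
    obtain \<alpha>' \<beta>' H' where l: "l = (\<alpha>', \<beta>', H')" by (cases l)
    define \<alpha> \<beta> H where "\<alpha> n = fst (s n)" and "\<beta> n = fst (snd (s n))" and "H n = snd (snd (s n))" for n
    have sn: "s n = (\<alpha> n, \<beta> n, H n)" for n by (simp add: \<alpha>_def \<beta>_def H_def)
    have \<alpha>: "(\<lambda>n. \<alpha> n i) \<longlonglongrightarrow> \<alpha>' i" and \<beta>: "(\<lambda>n. \<beta> n i) \<longlonglongrightarrow> \<beta>' i" for i
      using tendsto_fst[OF lim] tendsto_fst[OF tendsto_snd[OF lim]]
      by (simp_all add: l sn tendsto_fun_componentwise)
    have H: "H \<longlonglongrightarrow> H'"
      using tendsto_snd[OF tendsto_snd[OF lim]] by (simp add: l sn)
    have "l \<in> X"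
      using s supported_on_closed[of \<alpha> I, OF _ \<alpha>] supported_on_closed[of \<beta> J, OF _ \<beta>]
      by (simp add: X_def l sn)
    moreover have "F l \<le> liminf (\<lambda>n. F (s n))"
      unfolding l sn F_def prod.case
      by (rule objective_lincomb_lsc[OF st U V A eU fV ei fi \<alpha> \<beta> H])
    ultimately show "l \<in> X \<and> F l \<le> liminf (\<lambda>n. F (s n))" ..
  qed
  then obtain x where x: "\<And>y. y \<in> X \<Longrightarrow> F x \<le> F y" by blast
  obtain \<alpha> \<beta> H where "x = (\<alpha>, \<beta>, H)" by (rule prod_cases3)
  with x have min: "\<And>y. y \<in> X \<Longrightarrow> F (\<alpha>, \<beta>, H) \<le> F y" by simp
  have "F (\<alpha>, \<beta>, H) \<le> objective \<Omega> \<P> \<B> \<gamma> u m h"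
    if um: "u \<in> feature_space \<zeta> N \<omega>" "m \<in> feature_space \<zeta> N \<tau>" for u m h
  proof -
    obtain a b where ab: "u = lincomb e A a" "m = lincomb f A b" using um by (auto simp: FU FV)
    obtain a' where a': "a' \<in> supported_on I" "AE x in lebesgue. x \<in> \<Omega> \<longrightarrow> lincomb e A a x = lincomb e A a' x"
      using I(3) unfolding spanning_AE_def by blast
    obtain b' where b': "b' \<in> supported_on J" "AE x in lebesgue. x \<in> \<Omega> \<longrightarrow> lincomb f A b x = lincomb f A b' x"
      using J(3) unfolding spanning_AE_def by blast
    \<comment> \<open>Competitors are first replaced by almost everywhere equal ones with coefficients in \<open>X\<close>.\<close>
    have "F (\<alpha>, \<beta>, H) \<le> F (a', b', h)" using a' b' by (intro min) (simp add: X_def)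
    also have "\<dots> = objective \<Omega> \<P> \<B> \<gamma> u m h"
      unfolding F_def prod.case ab using assms(8-11) a'(2) b'(2)
      by (intro objective_cong_AE[OF st U V, symmetric]) (auto simp: FU FV)
    finally show ?thesis .
  qed
  then show ?thesis
    by (intro exI[of _ "lincomb e A \<alpha>"] exI[of _ "lincomb f A \<beta>"] exI[of _ H])
      (auto simp: is_arg_min_def FU FV F_def not_less)
qed

end
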